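(* Let $d\ge 2$ be an integer, let $C$ be a $d$-dimensional register, let $\eta = d(d+1)/2$, and consider the ensemble of two equiprobable states $\{\rho^0_C,\rho^1_C\}$ (each with probability $\tfrac12$), where $\rho^0_C = \mathrm{I}/d$ and $\rho^1_C$ is diagonal in the computational basis $\{|c\rangle\}_{c=1}^d$ with $(c,c)$-entry $(d-c+1)/\eta$. Put $\rho_{XC}=\tfrac12\sum_{x\in\{0,1\}}|x\rangle\langle x|_X\otimes\rho^x_C$ and $\varepsilon = \frac{1}{24\,d^4\log d}$ (independent of the number of copies $n$). Then, both under the global error criterion and under the local error criterion with error $\varepsilon$, every achievable rate $R$ (in bits of classical communication per copy) for entanglement-assisted blind compression of this ensemble satisfies $$R \ge (\log d) - 7,$$ while the Holevo information satisfies $\mathrm{I}(X:C)_\rho\le 1$. Thus the information defect (the infimum of the achievable rates at error $\varepsilon$ minus $\mathrm{I}(X:C)_\rho$) is at least $(\log d)-8$, even for local error; so it can be arbitrarily large, and it is near maximal for the dimension (its leading-order term $\log d$ saturates the dimension bound $\log d$).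
   Context: All logarithms are base 2; Hilbert spaces are finite dimensional; $\Delta(\rho,\sigma)=\frac12\|\rho-\sigma\|_1$ is the trace distance. For $\rho_{AB}$, $\mathrm{I}(A:B)_\rho=\mathrm{S}(A)_\rho+\mathrm{S}(B)_\rho-\mathrm{S}(AB)_\rho$ with $\mathrm{S}$ the von Neumann entropy; $\mathrm{I}(X:C)_\rho$ is the Holevo information of the ensemble. A map between registers means a completely positive trace preserving (CPTP) linear map. Entanglement-assisted blind distribution compression. Let $\{p(x),\rho^x_C\}$ be an ensemble of diagonal states and $\rho_{XC}=\sum_x p(x)|x\rangle\langle x|_X\otimes\rho^x_C$. A Referee and Alice share $\rho_{X_1C_1}\otimes\cdots\otimes\rho_{X_nC_n}$ ($n$ copies of $\rho_{XC}$), the Referee holding $X_1,\dots,X_n$ and Alice holding $C_1,\dots,C_n$. Alice and Bob share an arbitrary entangled state $|\theta\rangle_{E_AE_B}$ ($E_A$ with Alice, $E_B$ with Bob). In an $(n,R,\varepsilon)$-protocol Alice applies an encoding map $\mathcal{E}:C_1\cdots C_nE_A\to C_1\cdots C_nT$, where $T$ is a classical register of size $2^{nR}$, and sends $T$ to Bob, who applies a decoding map $\mathcal{D}:TE_B\to C'_1\cdots C'_n$ with each $C'_i\equiv C$ (the notation $\equiv$ means the registers have isomorphic Hilbert spaces). Since the ensemble is classical, one assumes without loss of generality that Alice retains a copy of her input, i.e. after the encoding and tracing out $T$ (and $E_B$) the state on $X_1C_1\cdots X_nC_n$ is still $\rho_{X_1C_1}\otimes\cdots\otimes\rho_{X_nC_n}$.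 Let $\tau$ be the final state of $X_1\cdots X_nC_1\cdots C_nC_1'\cdots C_n'$. Global error criterion: $\Delta(\tau_{X_1C_1'\cdots X_nC_n'},\rho_{X_1C_1'}\otimes\cdots\otimes\rho_{X_nC_n'})\le\varepsilon$, where $\rho_{X_iC'_i}$ is $\rho_{XC}$ with $C$ replaced by $C'_i$. Local error criterion: for every $i$, $\Delta(\tau_{X_iC'_i},\rho_{X_iC'_i})\le\varepsilon$. A rate $R$ is achievable at error $\varepsilon$ (for a given criterion) if there is a family of $(n,R,\varepsilon)$-protocols satisfying the criterion, labeled by $n$ (for all sufficiently large $n$). *)

theory Defs
  imports
    "Jordan_Normal_Form.Schur_Decomposition"
    "HOL-Library.Extended_Real"
begin

text \<open>
  Registers are given by their dimensions. The product basis of a composite register \<open>AB\<close> with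
  \<open>dim B = b\<close> is enumerated by \<open>(i, j) \<mapsto> i * b + j\<close>; longer composites are nested in this way,
  and the enumeration is associative. Operators are complex square matrices in the product basis.
\<close>

section \<open>Tensor products, partial traces and channels\<close>

definition tensor_mat :: "complex mat \<Rightarrow> complex mat \<Rightarrow> complex mat" where
  "tensor_mat A B = mat (dim_row A * dim_row B) (dim_col A * dim_col B)
     (\<lambda>(i, j). A $$ (i div dim_row B, j div dim_col B) * B $$ (i mod dim_row B, j mod dim_col B))"

definition mat_trace :: "complex mat \<Rightarrow> complex" where
  "mat_trace A = (\<Sum>i<dim_row A. A $$ (i, i))"

text \<open>Partial trace over the middle register of a system with dimensions \<open>l\<close>, \<open>m\<close>, \<open>r\<close>.\<close>

definition ptrace_mid :: "nat \<Rightarrow> nat \<Rightarrow> nat \<Rightarrow> complex mat \<Rightarrow> complex mat" where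
  "ptrace_mid l m r M = mat (l * r) (l * r)
     (\<lambda>(i, j). \<Sum>a<m. M $$ ((i div r) * (m * r) + a * r + i mod r,
                             (j div r) * (m * r) + a * r + j mod r))"

text \<open>The map \<open>id \<otimes> \<Phi> \<otimes> id\<close> on registers of dimensions \<open>l\<close>, \<open>m\<close>, \<open>r\<close>, where the linear map \<open>\<Phi>\<close>
  takes \<open>m \<times> m\<close> matrices to \<open>m' \<times> m'\<close> matrices. It applies \<open>\<Phi>\<close> to each of the blocks that are
  obtained by fixing the row and column indices of the two outer registers.\<close>

definition lift_map ::
  "nat \<Rightarrow> nat \<Rightarrow> nat \<Rightarrow> nat \<Rightarrow> (complex mat \<Rightarrow> complex mat) \<Rightarrow> complex mat \<Rightarrow> complex mat" where
  "lift_map l r m m' \<Phi> M = mat (l * m' * r) (l * m' * r)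
     (\<lambda>(i, j). \<Phi> (mat m m (\<lambda>(a, b).
          M $$ ((i div (m' * r)) * (m * r) + a * r + i mod r,
                (j div (m' * r)) * (m * r) + b * r + j mod r)))
        $$ (i div r mod m', j div r mod m'))"

text \<open>The order on \<^typ>\<open>complex\<close> makes \<open>0 \<le> z\<close> mean that \<open>z\<close> is real and nonnegative, so
  Hermiticity is implied.\<close>

definition pos_semidef :: "nat \<Rightarrow> complex mat \<Rightarrow> bool" where
  "pos_semidef m A \<longleftrightarrow> A \<in> carrier_mat m m \<and> (\<forall>v \<in> carrier_vec m. 0 \<le> (A *\<^sub>v v) \<bullet>c v)"

definition cptp :: "nat \<Rightarrow> nat \<Rightarrow> (complex mat \<Rightarrow> complex mat) \<Rightarrow> bool" where
  "cptp m m' \<Phi> \<longleftrightarrow>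
     (\<forall>A \<in> carrier_mat m m. \<Phi> A \<in> carrier_mat m' m') \<and>
     (\<forall>A \<in> carrier_mat m m. \<forall>B \<in> carrier_mat m m. \<Phi> (A + B) = \<Phi> A + \<Phi> B) \<and>
     (\<forall>A \<in> carrier_mat m m. \<forall>c. \<Phi> (c \<cdot>\<^sub>m A) = c \<cdot>\<^sub>m \<Phi> A) \<and>
     (\<forall>r M. pos_semidef (m * r) M \<longrightarrow> pos_semidef (m' * r) (lift_map 1 r m m' \<Phi> M)) \<and>
     (\<forall>A \<in> carrier_mat m m. mat_trace (\<Phi> A) = mat_trace A)"

section \<open>Trace distance and entropies\<close>

text \<open>\<open>Tr f(A)\<close> for a Hermitian matrix \<open>A\<close>, summing over the eigenvalues with multiplicity.\<close>

definition spectral_trace :: "(real \<Rightarrow> real) \<Rightarrow> complex mat \<Rightarrow> real" where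
  "spectral_trace f A = (\<Sum>z\<in>#proots (char_poly A). f (Re z))"

definition trace_norm :: "complex mat \<Rightarrow> real" where
  "trace_norm A = spectral_trace sqrt (mat_adjoint A * A)"

definition trace_distance :: "complex mat \<Rightarrow> complex mat \<Rightarrow> real" where
  "trace_distance A B = trace_norm (A - B) / 2"

definition von_neumann_entropy :: "complex mat \<Rightarrow> real" where
  "von_neumann_entropy \<rho> = - spectral_trace (\<lambda>x. x * log 2 x) \<rho>"

text \<open>Mutual information of a state on a register of dimension \<open>k\<close> and one of dimension \<open>d\<close>;
  on classical-quantum states it is the Holevo information of the ensemble.\<close>

definition mutual_information :: "nat \<Rightarrow> nat \<Rightarrow> complex mat \<Rightarrow> real" where
  "mutual_information k d \<rho> =
     von_neumann_entropy (ptrace_mid k d 1 \<rho>) + von_neumann_entropy (ptrace_mid 1 k d \<rho>)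
       - von_neumann_entropy \<rho>"

section \<open>Copies of a state on a pair of registers\<close>

text \<open>\<open>\<Sum>x<k. p x |x><x| \<otimes> \<rho> x\<close>\<close>

definition cq_state :: "nat \<Rightarrow> nat \<Rightarrow> (nat \<Rightarrow> real) \<Rightarrow> (nat \<Rightarrow> complex mat) \<Rightarrow> complex mat" where
  "cq_state k d p \<rho> = mat (k * d) (k * d)
     (\<lambda>(i, j). if i div d = j div d
               then of_real (p (i div d)) * \<rho> (i div d) $$ (i mod d, j mod d) else 0)"

text \<open>The registers \<open>X\<^sub>1 \<dots> X\<^sub>n\<close>, each of dimension \<open>k\<close>, are grouped into one register of dimension
  \<open>k ^ n\<close>, and \<open>C\<^sub>1 \<dots> C\<^sub>n\<close> into one of dimension \<open>d ^ n\<close>; a product basis element is encoded by its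
  digits in base \<open>k\<close> and base \<open>d\<close>. Given the index \<open>i\<close> of a basis element of \<open>X\<^sub>1 \<dots> X\<^sub>n C\<^sub>1 \<dots> C\<^sub>n\<close>,
  \<open>pair_index k d n l i\<close> is the index of its component in the \<open>l\<close>-th pair \<open>XC\<close>, for \<open>l < n\<close>.\<close>

definition pair_index :: "nat \<Rightarrow> nat \<Rightarrow> nat \<Rightarrow> nat \<Rightarrow> nat \<Rightarrow> nat" where
  "pair_index k d n l i = ((i div d ^ n) div k ^ l mod k) * d + (i mod d ^ n) div d ^ l mod d"

text \<open>The \<open>n\<close>-fold tensor power of the state \<open>\<omega>\<close> of \<open>XC\<close>, and the state of the \<open>l\<close>-th pair \<open>XC\<close>
  when the \<open>n\<close> pairs are in state \<open>M\<close>.\<close>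

definition iid_state :: "nat \<Rightarrow> nat \<Rightarrow> nat \<Rightarrow> complex mat \<Rightarrow> complex mat" where
  "iid_state k d n \<omega> = mat (k ^ n * d ^ n) (k ^ n * d ^ n)
     (\<lambda>(i, j). \<Prod>l<n. \<omega> $$ (pair_index k d n l i, pair_index k d n l j))"

definition pair_marginal :: "nat \<Rightarrow> nat \<Rightarrow> nat \<Rightarrow> nat \<Rightarrow> complex mat \<Rightarrow> complex mat" where
  "pair_marginal k d n l M = mat (k * d) (k * d)
     (\<lambda>(a, b). \<Sum>(i, j) \<in> {(i, j). i < k ^ n * d ^ n \<and> j < k ^ n * d ^ n \<and>
                   pair_index k d n l i = a \<and> pair_index k d n l j = b \<and>
                   (\<forall>m<n. m \<noteq> l \<longrightarrow> pair_index k d n m i = pair_index k d n m j)}. M $$ (i, j))"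

section \<open>Entanglement-assisted blind compression\<close>

record ea_protocol =
  ent_dim_A :: nat
  ent_dim_B :: nat
  ent_state :: "complex vec"
  encoder :: "complex mat \<Rightarrow> complex mat"
  decoder :: "complex mat \<Rightarrow> complex mat"

definition ket_bra :: "complex vec \<Rightarrow> complex mat" where
  "ket_bra v = mat (dim_vec v) (dim_vec v) (\<lambda>(i, j). v $ i * cnj (v $ j))"

text \<open>The number of values of the classical register \<open>T\<close>. A negative rate gives \<open>0\<close>, and then no
  trace-preserving encoder exists.\<close>

definition message_size :: "nat \<Rightarrow> real \<Rightarrow> nat" where
  "message_size n R = nat \<lfloor>2 powr (real n * R)\<rfloor>"

text \<open>The state of \<open>X\<^sup>n C\<^sup>n T E\<^sub>B\<close> after the encoding \<open>C\<^sup>n E\<^sub>A \<rightarrow> C\<^sup>n T\<close>, and the state of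
  \<open>X\<^sup>n C\<^sup>n C'\<^sup>n\<close> after the decoding \<open>T E\<^sub>B \<rightarrow> C'\<^sup>n\<close>.\<close>

definition encoded_state ::
  "nat \<Rightarrow> nat \<Rightarrow> complex mat \<Rightarrow> nat \<Rightarrow> real \<Rightarrow> ea_protocol \<Rightarrow> complex mat" where
  "encoded_state k d \<omega> n R P =
     lift_map (k ^ n) (ent_dim_B P) (d ^ n * ent_dim_A P) (d ^ n * message_size n R) (encoder P)
       (tensor_mat (iid_state k d n \<omega>) (ket_bra (ent_state P)))"

definition final_state ::
  "nat \<Rightarrow> nat \<Rightarrow> complex mat \<Rightarrow> nat \<Rightarrow> real \<Rightarrow> ea_protocol \<Rightarrow> complex mat" where
  "final_state k d \<omega> n R P =
     lift_map (k ^ n * d ^ n) 1 (message_size n R * ent_dim_B P) (d ^ n) (decoder P)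
       (encoded_state k d \<omega> n R P)"

text \<open>The fourth conjunct says that \<open>T\<close> is classical: the output of the encoder is block diagonal
  in the basis of \<open>T\<close>. The last one says that Alice retains a copy of her input.\<close>

definition is_protocol ::
  "nat \<Rightarrow> nat \<Rightarrow> complex mat \<Rightarrow> nat \<Rightarrow> real \<Rightarrow> ea_protocol \<Rightarrow> bool" where
  "is_protocol k d \<omega> n R P \<longleftrightarrow>
     (let t = message_size n R; a = ent_dim_A P; b = ent_dim_B P in
        ent_state P \<in> carrier_vec (a * b) \<and>
        ent_state P \<bullet>c ent_state P = 1 \<and>
        cptp (d ^ n * a) (d ^ n * t) (encoder P) \<and>
        (\<forall>M \<in> carrier_mat (d ^ n * a) (d ^ n * a). \<forall>i < d ^ n * t. \<forall>j < d ^ n * t.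
           i mod t \<noteq> j mod t \<longrightarrow> encoder P M $$ (i, j) = 0) \<and>
        cptp (t * b) (d ^ n) (decoder P) \<and>
        ptrace_mid (k ^ n * d ^ n) (t * b) 1 (encoded_state k d \<omega> n R P) = iid_state k d n \<omega>)"

datatype error_criterion = Global | Local

text \<open>Here \<open>\<tau>\<close> is the final state of \<open>X\<^sup>n C'\<^sup>n\<close>.\<close>

fun meets_criterion ::
  "error_criterion \<Rightarrow> nat \<Rightarrow> nat \<Rightarrow> complex mat \<Rightarrow> nat \<Rightarrow> real \<Rightarrow> complex mat \<Rightarrow> bool" where
  "meets_criterion Global k d \<omega> n \<epsilon> \<tau> \<longleftrightarrow> trace_distance \<tau> (iid_state k d n \<omega>) \<le> \<epsilon>"
| "meets_criterion Local k d \<omega> n \<epsilon> \<tau> \<longleftrightarrow>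
     (\<forall>l<n. trace_distance (pair_marginal k d n l \<tau>) \<omega> \<le> \<epsilon>)"

definition achievable ::
  "error_criterion \<Rightarrow> nat \<Rightarrow> nat \<Rightarrow> complex mat \<Rightarrow> real \<Rightarrow> real \<Rightarrow> bool" where
  "achievable crit k d \<omega> \<epsilon> R \<longleftrightarrow>
     (\<forall>\<^sub>F n in sequentially. \<exists>P. is_protocol k d \<omega> n R P \<and>
        meets_criterion crit k d \<omega> n \<epsilon>
          (ptrace_mid (k ^ n) (d ^ n) (d ^ n) (final_state k d \<omega> n R P)))"

text \<open>The infimum is taken in \<^typ>\<open>ereal\<close>, so it would be infinite if no rate were achievable.\<close>

definition information_defect ::
  "error_criterion \<Rightarrow> nat \<Rightarrow> nat \<Rightarrow> complex mat \<Rightarrow> real \<Rightarrow> ereal" where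
  "information_defect crit k d \<omega> \<epsilon> =
     (INF R \<in> {R. achievable crit k d \<omega> \<epsilon> R}. ereal R) - ereal (mutual_information k d \<omega>)"

section \<open>The ensemble\<close>

text \<open>Basis vectors are numbered from \<open>0\<close>, so the \<open>c\<close>-th diagonal entry \<open>(d - c + 1) / \<eta>\<close> for
  \<open>1 \<le> c \<le> d\<close> is the entry at index \<open>i = c - 1\<close>, where \<open>d - c + 1 = d - i\<close>.\<close>

definition ensemble_state :: "nat \<Rightarrow> nat \<Rightarrow> complex mat" where
  "ensemble_state d x =
     (if x = 0 then of_real (1 / real d) \<cdot>\<^sub>m 1\<^sub>m d
      else mat d d (\<lambda>(i, j). if i = j
             then of_real (real (d - i) / (real d * (real d + 1) / 2)) else 0))"

definition ensemble_XC :: "nat \<Rightarrow> complex mat" where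
  "ensemble_XC d = cq_state 2 d (\<lambda>_. 1 / 2) (ensemble_state d)"

definition ensemble_error :: "nat \<Rightarrow> real" where
  "ensemble_error d = 1 / (24 * real d ^ 4 * log 2 (real d))"

end

theory Submission
  imports Defs "HOL-Analysis.L2_Norm" "HOL-Real_Asymp.Real_Asymp"
begin

text \<open>
  A protocol is a classical channel \<open>W\<close> from \<open>C\<^sup>n\<close> to \<open>C'\<^sup>n\<close>. Because \<open>T\<close> is classical and Alice's
  encoding does not change the state of \<open>E\<^sub>B\<close>, what Bob holds is dominated by \<open>I\<^sub>T \<otimes> \<theta>\<^sub>B\<close> with \<open>\<theta>\<^sub>B\<close> the
  reduced state of \<open>E\<^sub>B\<close>; hence \<open>W(c'|c) \<le> Q(c')\<close>, where the total mass of \<open>Q\<close> is the message size.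
  On the other hand, the channel that \<open>W\<close> induces on a single letter nearly preserves both the
  uniform and the linear law, and a second-moment computation shows that it is then nearly the
  identity. So the number \<open>N\<close> of letters on which input and output agree satisfies
  \<open>E[d\<^sup>N] \<ge> d\<^bsup>(1 - \<delta>)n\<^esup>\<close>, while the domination by \<open>Q\<close> gives \<open>E[d\<^sup>N] \<le> 2\<^bsup>nR\<^esup> 3\<^sup>n\<close>, because each letter is
  hit with probability at most \<open>2/d\<close>. Conversely, copying the input into \<open>T\<close> has rate \<open>log d\<close>.
\<close>

section \<open>Trace norm and diagonal entries\<close>

text \<open>The local criterion sees one letter at a time: errors of different letters may be
  arbitrarily correlated, and every block may contain a constant fraction of wrong letters, so the
  probability that whole words agree says nothing. The moment E[d^N] is robust: by convexity its
  lower bound needs only E[N], a sum of single-letter probabilities, and the base d offsets the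
  chance of order 1/d of a blind hit. Global closeness passes to every pair, so one argument serves
  both criteria. Two states are enough to pin down a letter because the linear law acts as weight
  and as test function at once: with the output law kept uniform, it fixes the correlation of input
  and output, hence their mean squared distance. This costs a factor of order d^3 in the error, and
  the resulting loss \<delta> is multiplied by log d in the exponent, which explains an error of the
  form 1 / (poly(d) log d).\<close>

lemma mat_adjoint_eq:
  "mat_adjoint (A :: complex mat) = mat (dim_col A) (dim_row A) (\<lambda>(i, j). cnj (A $$ (j, i)))"
  by (rule eq_matI) (auto simp: mat_adjoint_def mat_of_rows_def)

lemma mat_adjoint_carrier:
  "A \<in> carrier_mat m n \<Longrightarrow> mat_adjoint (A :: complex mat) \<in> carrier_mat n m"
  by (auto simp: mat_adjoint_eq)

lemma mat_adjoint_mult: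
  fixes A B :: "complex mat"
  assumes "A \<in> carrier_mat m n" "B \<in> carrier_mat n k"
  shows "mat_adjoint (A * B) = mat_adjoint B * mat_adjoint A"
  using assms by (intro eq_matI) (auto simp: mat_adjoint_eq scalar_prod_def mult.commute)

lemma mat_adjoint_mult_index:
  fixes A B :: "complex mat"
  assumes "A \<in> carrier_mat m n" "B \<in> carrier_mat m k" "i < n" "j < k"
  shows "(mat_adjoint A * B) $$ (i, j) = (\<Sum>r<m. cnj (A $$ (r, i)) * B $$ (r, j))"
  using assms by (auto simp: mat_adjoint_eq scalar_prod_def lessThan_atLeast0 intro!: sum.cong)

lemma inner_complex_vec:
  "w \<in> carrier_vec n \<Longrightarrow> v \<bullet>c w = (\<Sum>i<n. v $ i * cnj ((w :: complex vec) $ i))"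
  by (auto simp: scalar_prod_def lessThan_atLeast0 intro!: sum.cong)

text \<open>Gram-Schmidt on a completion of \<open>v\<close> to a basis keeps \<open>v\<close> at
  its head. The orthogonal vectors that it returns still have to be divided by their norms
  \<open>r j\<close>, so the first column is \<open>v\<close> only up to the scalar
  \<open>c\<close>.\<close>

lemma unitary_with_first_column:
  fixes v :: "complex vec"
  assumes v: "v \<in> carrier_vec n" and v0: "v \<noteq> 0\<^sub>v n"
  obtains W c where "W \<in> carrier_mat n n" "mat_adjoint W * W = 1\<^sub>m n" "col W 0 = c \<cdot>\<^sub>v v"
proof -
  interpret cof_vec_space n "TYPE(complex)" .
  define b where "b = basis_completion v"
  define ws where "ws = gram_schmidt n b"
  note bc = basis_completion[OF v v0, folded b_def]
  have n0: "n \<noteq> 0"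
    using v v0 by auto
  obtain vs where bv: "b = v # vs"
    using bc(6,7) n0 by (cases b) auto
  note gs = gram_schmidt_result[OF bc(2,4,5) refl, folded ws_def]
  have hd_ws: "hd ws = v"
    using gram_schmidt_hd[OF v, of vs] by (simp add: ws_def bv)
  have len: "length ws = n"
    using gs(4) bc(6) by simp
  have wc: "ws ! j \<in> carrier_vec n" if "j < n" for j
    using gs(3) len that by auto
  define r where "r j = sqrt (Re (ws ! j \<bullet>c ws ! j))" for j
  have sq: "ws ! j \<bullet>c ws ! j = of_real ((r j)\<^sup>2)" and r0: "r j \<noteq> 0" if j: "j < n" for j
  proof -
    have "0 \<le> ws ! j \<bullet>c ws ! j"
      by (rule conjugate_square_ge_0_vec)
    then have im: "Im (ws ! j \<bullet>c ws ! j) = 0" and re: "0 \<le> Re (ws ! j \<bullet>c ws ! j)"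
      by (auto simp: less_eq_complex_def)
    show eq: "ws ! j \<bullet>c ws ! j = of_real ((r j)\<^sup>2)"
      using im re by (simp add: r_def complex_eq_iff)
    have "ws ! j \<bullet>c ws ! j \<noteq> 0"
      using corthogonalD[OF gs(2), of j j] j len by auto
    then show "r j \<noteq> 0"
      using eq by auto
  qed
  define W where "W = mat n n (\<lambda>(i, j). (ws ! j) $ i / of_real (r j))"
  have W: "W \<in> carrier_mat n n"
    by (simp add: W_def)
  have "mat_adjoint W * W = 1\<^sub>m n"
  proof (rule eq_matI)
    fix i j assume "i < dim_row (1\<^sub>m n :: complex mat)" "j < dim_col (1\<^sub>m n :: complex mat)"
    then have ij: "i < n" "j < n" by auto
    have "(mat_adjoint W * W) $$ (i, j) = (\<Sum>k<n. cnj (W $$ (k, i)) * W $$ (k, j))"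
      using mat_adjoint_mult_index[OF W W ij] .
    also have "\<dots> = (\<Sum>k<n. (ws ! j) $ k * cnj ((ws ! i) $ k)) / (of_real (r i) * of_real (r j))"
      using ij by (subst sum_divide_distrib, intro sum.cong) (auto simp: W_def)
    also have "\<dots> = (ws ! j \<bullet>c ws ! i) / (of_real (r i) * of_real (r j))"
      using inner_complex_vec[OF wc[OF ij(1)], of "ws ! j"] by simp
    also have "\<dots> = (if i = j then 1 else 0)"
      using corthogonalD[OF gs(2), of j i] ij len sq r0
      by (auto simp: power2_eq_square)
    finally show "(mat_adjoint W * W) $$ (i, j) = 1\<^sub>m n $$ (i, j)"
      using ij by simp
  qed (use W in \<open>auto simp: mat_adjoint_eq\<close>)
  moreover have "col W 0 = (1 / of_real (r 0)) \<cdot>\<^sub>v v"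
  proof -
    have "ws ! 0 = v"
      using hd_ws len n0 hd_conv_nth[of ws] by fastforce
    then show ?thesis
      using n0 v by (intro eq_vecI) (auto simp: W_def)
  qed
  ultimately show ?thesis
    using that W by blast
qed

lemma unitary_inverse:
  fixes U :: "complex mat"
  assumes "U \<in> carrier_mat n n" "mat_adjoint U * U = 1\<^sub>m n"
  shows "U * mat_adjoint U = 1\<^sub>m n"
  using assms mat_mult_left_right_inverse[of "mat_adjoint U" n U] mat_adjoint_carrier by auto

lemma unitary_mult:
  fixes U V :: "complex mat"
  assumes U: "U \<in> carrier_mat n n" and UU: "mat_adjoint U * U = 1\<^sub>m n"
    and V: "V \<in> carrier_mat n n" and VV: "mat_adjoint V * V = 1\<^sub>m n"
  shows "mat_adjoint (U * V) * (U * V) = 1\<^sub>m n"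
proof -
  have "mat_adjoint (U * V) * (U * V) = mat_adjoint V * (mat_adjoint U * U * V)"
    using U V mat_adjoint_carrier[OF U] mat_adjoint_carrier[OF V]
    by (simp add: mat_adjoint_mult[OF U V] assoc_mult_mat[of _ n n _ n _ n])
  then show ?thesis
    using V by (simp add: UU VV)
qed

lemma mat_adjoint_four_block:
  fixes A B C D :: "complex mat"
  assumes "A \<in> carrier_mat n1 m1" "B \<in> carrier_mat n1 m2" "C \<in> carrier_mat n2 m1" "D \<in> carrier_mat n2 m2"
  shows "mat_adjoint (four_block_mat A B C D) =
    four_block_mat (mat_adjoint A) (mat_adjoint C) (mat_adjoint B) (mat_adjoint D)"
  using assms by (intro eq_matI) (auto simp: mat_adjoint_eq)

text \<open>Schur's theorem by deflation: an eigenvector becomes the first basis vector and the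
  remaining block is handled by induction. The change of basis has to be unitary, since the trace
  norm estimate below uses that the columns of \<open>U\<close> are orthonormal.\<close>

lemma unitary_triangularization:
  fixes A :: "complex mat"
  assumes "A \<in> carrier_mat n n"
  shows "\<exists>U. U \<in> carrier_mat n n \<and> mat_adjoint U * U = 1\<^sub>m n \<and>
           upper_triangular (mat_adjoint U * A * U)"
  using assms
proof (induction n arbitrary: A)
  case 0
  then show ?case by (intro exI[of _ "1\<^sub>m 0"]) (auto intro!: eq_matI simp: mat_adjoint_eq)
next
  case (Suc n)
  note A = Suc.prems
  obtain as where as: "char_poly A = (\<Prod>a\<leftarrow>as. [:- a, 1:])" "length as = Suc n"
    using char_poly_factorized[OF A] by auto
  then obtain e where "poly (char_poly A) e = 0"
    by (cases as) auto
  then have "eigenvalue A e"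
    using eigenvalue_root_char_poly[OF A] by simp
  then obtain v where v: "v \<in> carrier_vec (Suc n)" "v \<noteq> 0\<^sub>v (Suc n)" "A *\<^sub>v v = e \<cdot>\<^sub>v v"
    using A by (auto simp: eigenvalue_def eigenvector_def)
  obtain W c where W: "W \<in> carrier_mat (Suc n) (Suc n)" and WW: "mat_adjoint W * W = 1\<^sub>m (Suc n)"
    and c: "col W 0 = c \<cdot>\<^sub>v v"
    using unitary_with_first_column[OF v(1,2)] by blast
  note W' = mat_adjoint_carrier[OF W]
  define M where "M = mat_adjoint W * A * W"
  have M: "M \<in> carrier_mat (Suc n) (Suc n)"
    unfolding M_def using W W' A by (intro mult_carrier_mat)
  \<comment> \<open>The first column of \<open>W\<close> is an eigenvector, so in the new basis the
    first column of \<open>M\<close> is \<open>e\<close> times the first unit vector. This makes the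
    lower left block \<open>A3\<close> vanish.\<close>
  have "col M 0 = mat_adjoint W *\<^sub>v (A *\<^sub>v col W 0)"
    unfolding M_def assoc_mult_mat[OF W' A W]
    by (simp only: col_mult2[OF W' mult_carrier_mat[OF A W] zero_less_Suc] col_mult2[OF A W zero_less_Suc])
  also have "A *\<^sub>v col W 0 = e \<cdot>\<^sub>v col W 0"
    using A v c by (simp add: mult_mat_vec smult_smult_assoc mult.commute)
  also have "mat_adjoint W *\<^sub>v (e \<cdot>\<^sub>v col W 0) = e \<cdot>\<^sub>v (mat_adjoint W *\<^sub>v col W 0)"
    using W W' by (auto simp: mult_mat_vec)
  also have "mat_adjoint W *\<^sub>v col W 0 = col (mat_adjoint W * W) 0"
    using W W' by (subst col_mult2[of _ "Suc n" "Suc n" _ "Suc n"]) auto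
  finally have col0: "col M 0 = e \<cdot>\<^sub>v unit_vec (Suc n) 0"
    by (simp add: WW)
  have M0: "M $$ (i, 0) = (if i = 0 then e else 0)" if "i < Suc n" for i
    using that arg_cong[OF col0, of "\<lambda>u. u $ i"] M by auto
  obtain A1 A2 A3 A4 where split: "split_block M 1 1 = (A1, A2, A3, A4)"
    by (cases "split_block M 1 1") auto
  have "dim_row M = 1 + n" "dim_col M = 1 + n" using M by auto
  note blk = split_block[OF split this]
  have A3: "A3 = 0\<^sub>m n 1"
    using split M0 M by (auto simp: split_block_def Let_def)
  obtain U where U: "U \<in> carrier_mat n n" "mat_adjoint U * U = 1\<^sub>m n"
      "upper_triangular (mat_adjoint U * A4 * U)"
    using Suc.IH[OF blk(4)] by blast
  note U' = mat_adjoint_carrier[OF U(1)]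
  \<comment> \<open>\<open>F\<close> fixes the eigenvector and triangularises its
    complement.\<close>
  define F where "F = four_block_mat (1\<^sub>m 1) (0\<^sub>m 1 n) (0\<^sub>m n 1) U"
  have adj: "mat_adjoint (1\<^sub>m k) = (1\<^sub>m k :: complex mat)"
    "mat_adjoint (0\<^sub>m k l) = (0\<^sub>m l k :: complex mat)" for k l
    by (auto intro!: eq_matI simp: mat_adjoint_eq)
  have F': "mat_adjoint F = four_block_mat (1\<^sub>m 1) (0\<^sub>m 1 n) (0\<^sub>m n 1) (mat_adjoint U)"
    unfolding F_def by (subst mat_adjoint_four_block[of _ 1 1 _ n _ n]) (auto simp: U adj)
  have F: "F \<in> carrier_mat (Suc n) (Suc n)"
    unfolding F_def using four_block_carrier_mat[of "1\<^sub>m 1" 1 1 U n n] U(1) by auto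
  note Fc = mat_adjoint_carrier[OF F]
  have FF: "mat_adjoint F * F = 1\<^sub>m (Suc n)"
    unfolding F' unfolding F_def using U U'
    by (subst mult_four_block_mat[of _ 1 1 _ n _ n _ _ 1 _ n]) (auto intro!: eq_matI)
  have ut: "upper_triangular (mat_adjoint F * M * F)"
  proof -
    have "mat_adjoint F * M = four_block_mat A1 A2 (0\<^sub>m n 1) (mat_adjoint U * A4)"
      unfolding F' blk(5) A3 using U U' blk(1-4)
      by (subst mult_four_block_mat[of _ 1 1 _ n _ n _ _ 1 _ n]) auto
    also have "\<dots> * F = four_block_mat A1 (A2 * U) (0\<^sub>m n 1) (mat_adjoint U * A4 * U)"
      unfolding F_def using U U' blk(1-4)
      by (subst mult_four_block_mat[of _ 1 1 _ n _ n _ _ 1 _ n]) auto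
    finally have "mat_adjoint F * M * F = four_block_mat A1 (A2 * U) (0\<^sub>m n 1) (mat_adjoint U * A4 * U)" .
    moreover have "upper_triangular A1" using blk(1) by auto
    ultimately show ?thesis
      using blk U U' M0 upper_triangular_four_block[of A1 1 "mat_adjoint U * A4 * U" n "A2 * U"]
      by auto
  qed
  have "mat_adjoint (W * F) * A * (W * F) = mat_adjoint F * M * F"
    unfolding M_def mat_adjoint_mult[OF W F] using W W' F Fc A
    by (simp add: assoc_mult_mat[of _ "Suc n" "Suc n" _ "Suc n" _ "Suc n"])
  then show ?case
    using ut unitary_mult[OF W WW F FF] W F by (intro exI[of _ "W * F"]) auto
qed

lemma spectral_trace_upper_triangular:
  assumes "A \<in> carrier_mat n n" "upper_triangular A"
  shows "spectral_trace f A = (\<Sum>i<n. f (Re (A $$ (i, i))))"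
proof -
  have "proots (\<Prod>x\<leftarrow>xs. [:- x, 1:]) = mset xs" for xs :: "complex list"
  proof (induction xs)
    case (Cons x xs)
    have "(\<Prod>x\<leftarrow>xs. [:- x, 1:]) \<noteq> 0"
      by (auto simp: prod_list_zero_iff)
    then show ?case
      using Cons by (simp add: proots_mult del: mult_pCons_left)
  qed simp
  then have "proots (char_poly A) = mset (diag_mat A)"
    by (simp add: char_poly_upper_triangular[OF assms])
  then have "spectral_trace f A = (\<Sum>x\<leftarrow>diag_mat A. f (Re x))"
    by (simp add: spectral_trace_def flip: sum_mset_sum_list mset_map)
  also have "\<dots> = (\<Sum>i<n. f (Re (A $$ (i, i))))"
    using assms(1) by (simp add: diag_mat_def o_def interv_sum_list_conv_sum_set_nat lessThan_atLeast0)
  finally show ?thesis .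
qed

text \<open>In a basis \<open>U\<close> that triangularises the Gram matrix of \<open>D\<close>, the
  singular values of \<open>D\<close> are the lengths of the columns of \<open>E = D * U\<close>.
  Expanding each diagonal entry of \<open>D = E * mat_adjoint U\<close> and applying Cauchy-Schwarz
  column by column leaves the sum of these lengths, because the columns of \<open>U\<close> have
  length 1.\<close>

lemma sum_abs_diag_le_trace_norm:
  assumes D: "D \<in> carrier_mat n n"
  shows "(\<Sum>i<n. cmod (D $$ (i, i))) \<le> trace_norm D"
proof -
  define H where "H = mat_adjoint D * D"
  have H: "H \<in> carrier_mat n n" unfolding H_def using D by (intro mult_carrier_mat[of _ n n] mat_adjoint_carrier)
  obtain U where U: "U \<in> carrier_mat n n" "mat_adjoint U * U = 1\<^sub>m n"
    and ut: "upper_triangular (mat_adjoint U * H * U)"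
    using unitary_triangularization[OF H] by blast
  note U' = mat_adjoint_carrier[OF U(1)]
  define B where "B = mat_adjoint U * H * U"
  have B: "B \<in> carrier_mat n n" unfolding B_def using U U' H by (intro mult_carrier_mat)
  define E where "E = D * U"
  have E: "E \<in> carrier_mat n n" unfolding E_def using D U by (intro mult_carrier_mat)
  have B_eq: "B = mat_adjoint E * E"
    unfolding B_def H_def E_def mat_adjoint_mult[OF D U(1)] using U U' D mat_adjoint_carrier[OF D]
    by (simp add: assoc_mult_mat[of _ n n _ n _ n])
  \<comment> \<open>Similarity preserves the characteristic polynomial, so the eigenvalues in
    \<open>trace_norm D\<close> can be read off the diagonal of the triangular
    \<open>B\<close>.\<close>
  have "similar_mat_wit B H (mat_adjoint U) U"
    using U U' B H unitary_inverse[OF U(1,2)] by (intro similar_mat_witI[of _ _ n]) (auto simp: B_def)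
  then have "char_poly B = char_poly H"
    using char_poly_similar similar_mat_def by blast
  then have tn: "trace_norm D = (\<Sum>k<n. sqrt (Re (B $$ (k, k))))"
    using spectral_trace_upper_triangular[OF B, of sqrt] ut
    by (simp add: trace_norm_def spectral_trace_def H_def B_def)
  have Bk: "sqrt (Re (B $$ (k, k))) = L2_set (\<lambda>i. cmod (E $$ (i, k))) {..<n}" if k: "k < n" for k
  proof -
    have "B $$ (k, k) = (\<Sum>i<n. of_real ((cmod (E $$ (i, k)))\<^sup>2))"
      unfolding B_eq mat_adjoint_mult_index[OF E E k k]
      by (intro sum.cong refl) (simp add: complex_norm_square mult.commute flip: of_real_power)
    then show ?thesis
      by (simp add: L2_set_def)
  qed
  have Uk: "L2_set (\<lambda>i. cmod (U $$ (i, k))) {..<n} = 1" if k: "k < n" for k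
  proof -
    have "(\<Sum>i<n. complex_of_real ((cmod (U $$ (i, k)))\<^sup>2)) = (mat_adjoint U * U) $$ (k, k)"
      unfolding mat_adjoint_mult_index[OF U(1) U(1) k k]
      by (intro sum.cong refl) (simp add: complex_norm_square mult.commute flip: of_real_power)
    also have "\<dots> = 1" using U k by simp
    finally have "(\<Sum>i<n. (cmod (U $$ (i, k)))\<^sup>2) = 1"
      by (metis of_real_sum of_real_eq_1_iff)
    then show ?thesis by (simp add: L2_set_def)
  qed
  have "D = E * mat_adjoint U"
    unfolding E_def using D U U' unitary_inverse[OF U(1,2)] by (simp add: assoc_mult_mat[of _ n n _ n _ n])
  then have Dii: "D $$ (i, i) = (\<Sum>k<n. E $$ (i, k) * cnj (U $$ (i, k)))" if "i < n" for i
    using that E U U' by (auto simp: scalar_prod_def mat_adjoint_eq lessThan_atLeast0 intro!: sum.cong)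
  have "(\<Sum>i<n. cmod (D $$ (i, i))) \<le> (\<Sum>i<n. \<Sum>k<n. \<bar>cmod (E $$ (i, k))\<bar> * \<bar>cmod (U $$ (i, k))\<bar>)"
    by (intro sum_mono) (auto simp: Dii intro!: order.trans[OF norm_sum] simp: norm_mult)
  also have "\<dots> = (\<Sum>k<n. \<Sum>i<n. \<bar>cmod (E $$ (i, k))\<bar> * \<bar>cmod (U $$ (i, k))\<bar>)"
    by (rule sum.swap)
  also have "\<dots> \<le> (\<Sum>k<n. L2_set (\<lambda>i. cmod (E $$ (i, k))) {..<n} * L2_set (\<lambda>i. cmod (U $$ (i, k))) {..<n})"
    by (intro sum_mono L2_set_mult_ineq)
  also have "\<dots> = trace_norm D"
    unfolding tn by (intro sum.cong) (auto simp: Bk Uk)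
  finally show ?thesis .
qed

text \<open>The lower bound uses an error criterion only in this form: the measurement statistics in
  the computational basis are close in the l1 norm.\<close>

lemma trace_distance_diag:
  assumes "A \<in> carrier_mat n n" "B \<in> carrier_mat n n"
  shows "(\<Sum>i<n. cmod (A $$ (i, i) - B $$ (i, i))) \<le> 2 * trace_distance A B"
proof -
  have "A - B \<in> carrier_mat n n" using assms(2) by (rule minus_carrier_mat)
  then show ?thesis
    using sum_abs_diag_le_trace_norm[of "A - B" n] assms by (auto simp: trace_distance_def)
qed

lemma trace_distance_self:
  assumes "A \<in> carrier_mat n n"
  shows "trace_distance A A = 0"
proof -
  have "A - A = 0\<^sub>m n n" "mat_adjoint (0\<^sub>m n n) * 0\<^sub>m n n = (0\<^sub>m n n :: complex mat)"
    using assms by (auto simp: mat_adjoint_eq)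
  then show ?thesis
    by (simp add: trace_distance_def trace_norm_def spectral_trace_upper_triangular[of _ n])
qed

section \<open>Positive semidefinite matrices and channels\<close>

lemma pair_less: "x < k \<Longrightarrow> a < m \<Longrightarrow> x * m + a < k * (m :: nat)"
proof -
  assume "x < k" "a < m"
  then have "x * m + a < Suc x * m" by simp
  also have "\<dots> \<le> k * m" using \<open>x < k\<close> by (intro mult_le_mono1) simp
  finally show ?thesis .
qed

lemma div_pair [simp]: "a < m \<Longrightarrow> (x * m + a) div m = (x :: nat)"
  and mod_pair [simp]: "a < m \<Longrightarrow> (x * m + a) mod m = (a :: nat)"
  by simp_all

lemma pair_cases:
  assumes "i < k * (m :: nat)"
  obtains x a where "x < k" "a < m" "i = x * m + a"
proof -
  have "m > 0" using assms by (cases m) auto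
  then show ?thesis
    using that[of "i div m" "i mod m"] assms by (simp add: less_mult_imp_div_less)
qed

lemma sum_pair: "(\<Sum>i<k * m. f i) = (\<Sum>x<k. \<Sum>a<m. f (x * m + a :: nat))"
proof -
  have "sum f {x * m..<x * m + m} = (\<Sum>a<m. f (x * m + a))" for x
    by (rule sum.reindex_bij_witness[of _ "\<lambda>a. x * m + a" "\<lambda>i. i - x * m"]) auto
  then show ?thesis
    using sum.nat_group[of f m k] by simp
qed

lemma mat_trace_pair:
  "A \<in> carrier_mat (k * m) (k * m) \<Longrightarrow> mat_trace A = (\<Sum>x<k. \<Sum>a<m. A $$ (x * m + a, x * m + a))"
  by (auto simp: mat_trace_def sum_pair)

text \<open>As rewrite rules, this and the next lemma pull a condition on outer indices out of an
  inner sum, so that nested delta sums collapse one level at a time.\<close>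

lemma sum_if: "(\<Sum>j\<in>A. if b then f j else g j) = (if b then sum f A else sum g A)"
  by simp

lemma sum_if_zero: "(\<Sum>j\<in>A. if b then f j else 0) = (if b then sum f A else 0)"
  by simp

text \<open>Test vectors are functions on indices, so that a vector supported on one block of a
  composite register can be written down without reindexing.\<close>

definition quadratic_form :: "nat \<Rightarrow> complex mat \<Rightarrow> (nat \<Rightarrow> complex) \<Rightarrow> complex" where
  "quadratic_form m A f = (\<Sum>i<m. \<Sum>j<m. cnj (f i) * A $$ (i, j) * f j)"

lemma pos_semidef_iff:
  "pos_semidef m A \<longleftrightarrow> A \<in> carrier_mat m m \<and> (\<forall>f. 0 \<le> quadratic_form m A f)"
proof -
  have *: "(A *\<^sub>v v) \<bullet>c v = quadratic_form m A (\<lambda>i. v $ i)"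
    if "A \<in> carrier_mat m m" "v \<in> carrier_vec m" for v
  proof -
    have "(A *\<^sub>v v) \<bullet>c v = (\<Sum>i<m. (\<Sum>j<m. A $$ (i, j) * v $ j) * cnj (v $ i))"
      using that by (subst inner_complex_vec[OF that(2)])
        (auto simp: scalar_prod_def lessThan_atLeast0 intro!: sum.cong)
    then show ?thesis
      by (simp add: quadratic_form_def sum_distrib_right sum_distrib_left mult_ac)
  qed
  have "0 \<le> quadratic_form m A f" if "A \<in> carrier_mat m m"
      "\<forall>v\<in>carrier_vec m. 0 \<le> (A *\<^sub>v v) \<bullet>c v" for f
  proof -
    have "quadratic_form m A f = quadratic_form m A (\<lambda>i. vec m f $ i)"
      by (auto simp: quadratic_form_def intro!: sum.cong)
    moreover have "0 \<le> (A *\<^sub>v vec m f) \<bullet>c vec m f" using that(2) by simp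
    ultimately show ?thesis using *[OF that(1), of "vec m f"] by simp
  qed
  then show ?thesis
    using * by (auto simp: pos_semidef_def)
qed

lemma quadratic_form_block:
  assumes "z < m"
  shows "quadratic_form (m * r) M (\<lambda>i. if i div r = z then f (i mod r) else 0) =
    (\<Sum>i<r. \<Sum>j<r. cnj (f i) * M $$ (z * r + i, z * r + j) * f j)"
proof -
  have "quadratic_form (m * r) M (\<lambda>i. if i div r = z then f (i mod r) else 0) =
    (\<Sum>x<m. \<Sum>i<r. \<Sum>y<m. \<Sum>j<r. if x = z then if y = z then
       cnj (f i) * M $$ (x * r + i, y * r + j) * f j else 0 else 0)"
    unfolding quadratic_form_def sum_pair by (intro sum.cong refl) auto
  then show ?thesis
    using assms by (simp add: sum_if_zero)
qed

lemma pos_semidef_block: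
  assumes "pos_semidef (m * r) M" "z < m"
  shows "0 \<le> (\<Sum>i<r. \<Sum>j<r. cnj (f i) * M $$ (z * r + i, z * r + j) * f j)"
  using assms(1) quadratic_form_block[OF assms(2), of r M f] by (metis pos_semidef_iff)

lemma pos_semidef_ket_bra: "pos_semidef (dim_vec v) (ket_bra v)"
proof -
  have "quadratic_form (dim_vec v) (ket_bra v) f =
      (\<Sum>i<dim_vec v. cnj (f i) * v $ i) * cnj (\<Sum>i<dim_vec v. cnj (f i) * v $ i)" for f
    unfolding quadratic_form_def cnj_sum sum_product by (intro sum.cong refl) (simp add: ket_bra_def)
  moreover have "0 \<le> z * cnj z" for z
    by (simp add: less_eq_complex_def)
  ultimately have "0 \<le> quadratic_form (dim_vec v) (ket_bra v) f" for f
    by metis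
  then show ?thesis
    by (simp add: pos_semidef_iff) (simp add: ket_bra_def)
qed

text \<open>The partial trace over the first register is the sum of the diagonal blocks, each of
  which is positive.\<close>

lemma pos_semidef_ptrace:
  assumes "pos_semidef (m * r) M"
  shows "pos_semidef r (ptrace_mid 1 m r M)"
proof -
  have "quadratic_form r (ptrace_mid 1 m r M) f =
      (\<Sum>z<m. \<Sum>i<r. \<Sum>j<r. cnj (f i) * M $$ (z * r + i, z * r + j) * f j)" for f
  proof -
    have "quadratic_form r (ptrace_mid 1 m r M) f =
      (\<Sum>i<r. \<Sum>j<r. \<Sum>z<m. cnj (f i) * M $$ (z * r + i, z * r + j) * f j)"
      by (auto simp: quadratic_form_def ptrace_mid_def sum_distrib_left sum_distrib_right intro!: sum.cong)
    also have "\<dots> = (\<Sum>i<r. \<Sum>z<m. \<Sum>j<r. cnj (f i) * M $$ (z * r + i, z * r + j) * f j)"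
      by (intro sum.cong refl sum.swap)
    also have "\<dots> = (\<Sum>z<m. \<Sum>i<r. \<Sum>j<r. cnj (f i) * M $$ (z * r + i, z * r + j) * f j)"
      by (rule sum.swap)
    finally show ?thesis .
  qed
  then show ?thesis
    using pos_semidef_block[OF assms]
    by (auto simp: pos_semidef_iff intro!: sum_nonneg[where A = "{..<m}"]) (simp add: ptrace_mid_def)
qed

lemma pos_semidef_diag:
  assumes "pos_semidef m A" "i < m"
  shows "0 \<le> A $$ (i, i)"
proof -
  have "quadratic_form m A (\<lambda>j. if j = i then 1 else 0) =
    (\<Sum>k<m. \<Sum>j<m. if k = i then if j = i then A $$ (k, j) else 0 else 0)"
    unfolding quadratic_form_def by (intro sum.cong refl) auto
  also have "\<dots> = A $$ (i, i)" using assms by (simp add: sum_if_zero)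
  finally show ?thesis
    using assms by (metis pos_semidef_iff)
qed

section \<open>Consequences of complete positivity and linearity\<close>

lemma cptpD:
  assumes "cptp m m' \<Phi>"
  shows cptp_carrier: "A \<in> carrier_mat m m \<Longrightarrow> \<Phi> A \<in> carrier_mat m' m'"
    and cptp_add: "A \<in> carrier_mat m m \<Longrightarrow> B \<in> carrier_mat m m \<Longrightarrow> \<Phi> (A + B) = \<Phi> A + \<Phi> B"
    and cptp_smult: "A \<in> carrier_mat m m \<Longrightarrow> \<Phi> (c \<cdot>\<^sub>m A) = c \<cdot>\<^sub>m \<Phi> A"
    and cptp_lift: "pos_semidef (m * r) M \<Longrightarrow> pos_semidef (m' * r) (lift_map 1 r m m' \<Phi> M)"
    and cptp_trace: "A \<in> carrier_mat m m \<Longrightarrow> mat_trace (\<Phi> A) = mat_trace A"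
  using assms by (auto simp: cptp_def)

text \<open>Positivity is complete positivity with an ancilla of dimension 1.\<close>

lemma cptp_positive:
  assumes \<Phi>: "cptp m m' \<Phi>" and A: "pos_semidef m A"
  shows "pos_semidef m' (\<Phi> A)"
proof -
  have c: "A \<in> carrier_mat m m" using A by (simp add: pos_semidef_def)
  have "mat m m (\<lambda>(a, b). A $$ (a, b)) = A"
    using c by (intro eq_matI) auto
  then have "lift_map 1 1 m m' \<Phi> A = \<Phi> A"
    using cptp_carrier[OF \<Phi> c] by (intro eq_matI) (auto simp: lift_map_def)
  then show ?thesis
    using cptp_lift[OF \<Phi>, of 1 A] A by simp
qed

text \<open>Linearity for finite combinations of matrices given entrywise, which is the form in
  which \<open>lift_map\<close> hands its blocks to a channel.\<close>

lemma cptp_sum: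
  assumes \<Phi>: "cptp m m' \<Phi>" and "finite S" and pq: "p < m'" "q < m'"
  shows "\<Phi> (mat m m (\<lambda>ij. \<Sum>s\<in>S. w s * F s ij)) $$ (p, q) =
    (\<Sum>s\<in>S. w s * \<Phi> (mat m m (F s)) $$ (p, q))"
  using \<open>finite S\<close>
proof induction
  case empty
  have "mat m m (\<lambda>ij. 0) = 0 \<cdot>\<^sub>m (0\<^sub>m m m :: complex mat)"
    by (intro eq_matI) auto
  then show ?case
    using cptp_smult[OF \<Phi>, of "0\<^sub>m m m" 0] cptp_carrier[OF \<Phi>, of "0\<^sub>m m m"] pq by simp (metis carrier_matD index_smult_mat(1) mult_zero_left)
next
  case (insert s S)
  have "mat m m (\<lambda>ij. \<Sum>s\<in>insert s S. w s * F s ij) =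
      w s \<cdot>\<^sub>m mat m m (F s) + mat m m (\<lambda>ij. \<Sum>s\<in>S. w s * F s ij)"
    using insert by (intro eq_matI) auto
  then show ?case
    using insert pq cptp_carrier[OF \<Phi>, of "mat m m (F s)"]
      cptp_carrier[OF \<Phi>, of "mat m m (\<lambda>ij. \<Sum>s\<in>S. w s * F s ij)"]
    by (auto simp: cptp_add[OF \<Phi>] cptp_smult[OF \<Phi>])
qed

section \<open>The classical channel of a protocol\<close>

text \<open>A single use of the protocol in which the words of length \<open>n\<close> form one
  alphabet of size \<open>D\<close>; their product structure enters only later.\<close>

locale ea_code =
  fixes D t a b :: nat and \<theta> :: "complex vec" and enc dec :: "complex mat \<Rightarrow> complex mat"
  assumes \<theta>: "\<theta> \<in> carrier_vec (a * b)" and \<theta>_unit: "\<theta> \<bullet>c \<theta> = 1"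
    and enc: "cptp (D * a) (D * t) enc"
    and enc_classical: "\<And>M i j. \<lbrakk>M \<in> carrier_mat (D * a) (D * a); i < D * t; j < D * t;
          i mod t \<noteq> j mod t\<rbrakk> \<Longrightarrow> enc M $$ (i, j) = 0"
    and dec: "cptp (t * b) D dec"
begin

text \<open>The basis word \<open>c\<close> tensored with \<theta>. Since the source is diagonal,
  the actual input is a mixture of these vectors.\<close>

definition input_vec :: "nat \<Rightarrow> complex vec" where
  "input_vec c = vec (D * a * b) (\<lambda>i. if i div (a * b) = c then \<theta> $ (i mod (a * b)) else 0)"

text \<open>The encoder acts on \<open>C\<^sup>n E\<^sub>A\<close> only, so \<open>lift_map\<close> feeds it the blocks of the input with
  fixed row index \<open>e\<close> and column index \<open>e'\<close> of \<open>E\<^sub>B\<close>.\<close>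

definition input_block :: "nat \<Rightarrow> nat \<Rightarrow> nat \<Rightarrow> complex mat" where
  "input_block c e e' = mat (D * a) (D * a) (\<lambda>(i, j). if i div a = c \<and> j div a = c
     then \<theta> $ (i mod a * b + e) * cnj (\<theta> $ (j mod a * b + e')) else 0)"

definition encoded :: "nat \<Rightarrow> complex mat" where
  "encoded c = lift_map 1 b (D * a) (D * t) enc (ket_bra (input_vec c))"

definition received :: "nat \<Rightarrow> complex mat" where
  "received c = ptrace_mid 1 D (t * b) (encoded c)"

text \<open>Entries of the partial trace of \<theta> over \<open>E_A\<close>;
  \<open>dominating\<close> is the identity on \<open>T\<close> tensored with this state.\<close>

definition bob_marginal :: "nat \<Rightarrow> nat \<Rightarrow> complex" where
  "bob_marginal e e' = (\<Sum>i<a. \<theta> $ (i * b + e) * cnj (\<theta> $ (i * b + e')))"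

definition dominating :: "complex mat" where
  "dominating = mat (t * b) (t * b)
     (\<lambda>(i, j). if i div b = j div b then bob_marginal (i mod b) (j mod b) else 0)"

section \<open>Bob's states and the operator that dominates them\<close>

lemma pair_assoc: "(x * m + y) * r + z = x * (m * r) + (y * r + z)" for x m y r z :: nat
  by (simp add: algebra_simps)

lemma input_vec_index:
  assumes "c' < D" "i < a" "e < b"
  shows "input_vec c $ ((c' * a + i) * b + e) = (if c' = c then \<theta> $ (i * b + e) else 0)"
proof -
  have "i * b + e < a * b" using assms by (intro pair_less)
  moreover have "(c' * a + i) * b + e < D * a * b" using assms by (intro pair_less)
  ultimately show ?thesis
    unfolding input_vec_def pair_assoc by (simp add: mult.assoc)
qed

lemma encoded_index:
  assumes "y < D * t" "y' < D * t" "e < b" "e' < b"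
  shows "encoded c $$ (y * b + e, y' * b + e') = enc (input_block c e e') $$ (y, y')"
proof -
  have "mat (D * a) (D * a) (\<lambda>(i, j). ket_bra (input_vec c) $$ (i * b + e, j * b + e')) = input_block c e e'"
  proof (rule eq_matI)
    fix i j assume "i < dim_row (input_block c e e')" "j < dim_col (input_block c e e')"
    then have "i < D * a" "j < D * a" by (auto simp: input_block_def)
    moreover from this obtain x k y l where "x < D" "k < a" "i = x * a + k" "y < D" "l < a" "j = y * a + l"
      by (metis pair_cases)
    moreover have "dim_vec (input_vec c) = D * a * b" by (simp add: input_vec_def)
    ultimately show "mat (D * a) (D * a) (\<lambda>(i, j). ket_bra (input_vec c) $$ (i * b + e, j * b + e')) $$ (i, j)
        = input_block c e e' $$ (i, j)"
      using assms pair_less[of i "D * a" e b] pair_less[of j "D * a" e' b]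
      by (simp add: ket_bra_def input_vec_index input_block_def)
  qed (auto simp: input_block_def)
  moreover have "y * b + e < D * t * b" "y' * b + e' < D * t * b"
    using assms by (auto intro: pair_less)
  ultimately show ?thesis
    using assms by (simp add: encoded_def lift_map_def)
qed

text \<open>Complete positivity of the encoder in earnest: \<open>E_B\<close> is the ancilla,
  entangled with the part on which the encoder acts.\<close>

lemma encoded_psd: "pos_semidef (D * (t * b)) (encoded c)"
proof -
  have "dim_vec (input_vec c) = D * a * b" by (simp add: input_vec_def)
  then show ?thesis
    using cptp_lift[OF enc, of b "ket_bra (input_vec c)"] pos_semidef_ket_bra[of "input_vec c"]
    by (simp add: encoded_def mult.assoc)
qed

lemma received_psd: "pos_semidef (t * b) (received c)"
  unfolding received_def by (rule pos_semidef_ptrace[OF encoded_psd])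

lemma input_block_carrier: "input_block c e e' \<in> carrier_mat (D * a) (D * a)"
  by (simp add: input_block_def)

lemma received_index:
  assumes "y < t" "y' < t" "e < b" "e' < b"
  shows "received c $$ (y * b + e, y' * b + e') = (\<Sum>z<D. enc (input_block c e e') $$ (z * t + y, z * t + y'))"
proof -
  have l: "y * b + e < t * b" "y' * b + e' < t * b" using assms by (auto intro: pair_less)
  then have "received c $$ (y * b + e, y' * b + e') =
      (\<Sum>z<D. encoded c $$ ((z * t + y) * b + e, (z * t + y') * b + e'))"
    unfolding pair_assoc by (simp add: received_def ptrace_mid_def add.assoc)
  also have "\<dots> = (\<Sum>z<D. enc (input_block c e e') $$ (z * t + y, z * t + y'))"
    using assms by (intro sum.cong refl encoded_index) (auto intro: pair_less)
  finally show ?thesis .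
qed

lemma received_classical:
  assumes "y < t" "y' < t" "e < b" "e' < b" "y \<noteq> y'"
  shows "received c $$ (y * b + e, y' * b + e') = 0"
  unfolding received_index[OF assms(1-4)] using assms
  by (intro sum.neutral ballI enc_classical[OF input_block_carrier]) (auto intro: pair_less)

text \<open>Tracing out everything that the encoder outputs reduces it to the trace, which it
  preserves. So without the message Bob's half of \<theta> carries no trace of
  \<open>c\<close>.\<close>

lemma received_no_signalling:
  assumes c: "c < D" and e: "e < b" "e' < b"
  shows "(\<Sum>y<t. received c $$ (y * b + e, y * b + e')) = bob_marginal e e'"
proof -
  have "(\<Sum>y<t. received c $$ (y * b + e, y * b + e')) =
      (\<Sum>y<t. \<Sum>z<D. enc (input_block c e e') $$ (z * t + y, z * t + y))"
    using e by (intro sum.cong refl received_index) auto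
  also have "\<dots> = (\<Sum>z<D. \<Sum>y<t. enc (input_block c e e') $$ (z * t + y, z * t + y))"
    by (rule sum.swap)
  also have "\<dots> = mat_trace (enc (input_block c e e'))"
    using mat_trace_pair[OF cptp_carrier[OF enc input_block_carrier]] by simp
  also have "\<dots> = mat_trace (input_block c e e')"
    by (rule cptp_trace[OF enc input_block_carrier])
  also have "\<dots> = (\<Sum>x<D. \<Sum>i<a. input_block c e e' $$ (x * a + i, x * a + i))"
    by (rule mat_trace_pair[OF input_block_carrier])
  also have "\<dots> = (\<Sum>x<D. if x = c then bob_marginal e e' else 0)"
    by (intro sum.cong refl) (auto simp: input_block_def bob_marginal_def pair_less)
  finally show ?thesis using c by simp
qed

lemma bob_marginal_trace: "(\<Sum>e<b. bob_marginal e e) = 1"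
proof -
  have "(\<Sum>e<b. bob_marginal e e) = (\<Sum>i<a. \<Sum>e<b. \<theta> $ (i * b + e) * cnj (\<theta> $ (i * b + e)))"
    unfolding bob_marginal_def by (rule sum.swap)
  also have "\<dots> = \<theta> \<bullet>c \<theta>"
    unfolding inner_complex_vec[OF \<theta>] sum_pair ..
  finally show ?thesis by (simp add: \<theta>_unit)
qed

lemma received_trace:
  assumes "c < D"
  shows "mat_trace (received c) = 1"
proof -
  have "mat_trace (received c) = (\<Sum>y<t. \<Sum>e<b. received c $$ (y * b + e, y * b + e))"
    using received_psd[of c] by (intro mat_trace_pair) (simp add: pos_semidef_def)
  also have "\<dots> = (\<Sum>e<b. \<Sum>y<t. received c $$ (y * b + e, y * b + e))"
    by (rule sum.swap)
  finally show ?thesis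
    using received_no_signalling[OF assms] bob_marginal_trace by simp
qed

lemma dominating_trace: "mat_trace dominating = of_nat t"
proof -
  have "mat_trace dominating = (\<Sum>y<t. \<Sum>e<b. dominating $$ (y * b + e, y * b + e))"
    by (intro mat_trace_pair) (simp add: dominating_def)
  also have "\<dots> = (\<Sum>y<t. \<Sum>e<b. bob_marginal e e)"
    by (intro sum.cong refl) (auto simp: dominating_def pair_less)
  finally show ?thesis by (simp add: bob_marginal_trace)
qed

text \<open>Because \<open>T\<close> is classical, \<open>received c\<close> is block diagonal over
  the message values. Its blocks are positive and sum to the reduced state of \<open>E_B\<close>, so
  each single block is at most that state.\<close>

lemma received_le_dominating:
  assumes "c < D"
  shows "pos_semidef (t * b) (dominating - received c)"
proof -
  have rc: "received c \<in> carrier_mat (t * b) (t * b)"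
    using received_psd[of c] by (simp add: pos_semidef_def)
  have dc: "dominating \<in> carrier_mat (t * b) (t * b)"
    by (simp add: dominating_def)
  have "0 \<le> quadratic_form (t * b) (dominating - received c) f" for f
  proof -
    define g where "g y e = f (y * b + e)" for y e
    define q where "q y z = (\<Sum>e<b. \<Sum>e'<b. cnj (g y e) * received c $$ (z * b + e, z * b + e') * g y e')" for y z
    have q0: "0 \<le> q y z" if "z < t" for y z
      unfolding q_def by (rule pos_semidef_block[OF received_psd that])
    \<comment> \<open>By no-signalling, the block of the difference at the message value
      \<open>y\<close> is the sum of the blocks of \<open>received c\<close> at all other
      values.\<close>
    have d: "(dominating - received c) $$ (y * b + e, y' * b + e') =
        (if y = y' then \<Sum>z\<in>{..<t} - {y}. received c $$ (z * b + e, z * b + e') else 0)"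
      if "y < t" "y' < t" "e < b" "e' < b" for y y' e e'
    proof -
      have "(\<Sum>z<t. received c $$ (z * b + e, z * b + e')) = received c $$ (y * b + e, y * b + e') +
          (\<Sum>z\<in>{..<t} - {y}. received c $$ (z * b + e, z * b + e'))"
        using that by (intro sum.remove) auto
      then show ?thesis
        using that rc received_no_signalling[OF assms that(3,4)] received_classical[OF that]
        by (auto simp: dominating_def pair_less)
    qed
    have "quadratic_form (t * b) (dominating - received c) f = (\<Sum>y<t. \<Sum>e<b. \<Sum>y'<t. \<Sum>e'<b.
        cnj (g y e) * (dominating - received c) $$ (y * b + e, y' * b + e') * g y' e')"
      by (simp add: quadratic_form_def sum_pair g_def)
    also have "\<dots> = (\<Sum>y<t. \<Sum>e<b. \<Sum>y'<t. \<Sum>e'<b. if y' = y then \<Sum>z\<in>{..<t} - {y}.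
        cnj (g y e) * received c $$ (z * b + e, z * b + e') * g y e' else 0)"
      by (intro sum.cong refl) (simp add: d sum_distrib_left sum_distrib_right)
    also have "\<dots> = (\<Sum>y<t. \<Sum>e<b. \<Sum>e'<b. \<Sum>z\<in>{..<t} - {y}.
        cnj (g y e) * received c $$ (z * b + e, z * b + e') * g y e')"
      by (simp add: sum_if_zero)
    also have "\<dots> = (\<Sum>y<t. \<Sum>e<b. \<Sum>z\<in>{..<t} - {y}. \<Sum>e'<b.
        cnj (g y e) * received c $$ (z * b + e, z * b + e') * g y e')"
      by (intro sum.cong refl sum.swap)
    also have "\<dots> = (\<Sum>y<t. \<Sum>z\<in>{..<t} - {y}. q y z)"
      unfolding q_def by (intro sum.cong refl sum.swap)
    finally show ?thesis
      using q0 by (auto intro!: sum_nonneg)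
  qed
  then show ?thesis
    using rc dc by (simp add: pos_semidef_iff minus_carrier_mat)
qed

text \<open>The probability that Bob reads \<open>c'\<close> when he measures his output in the
  computational basis and the input word is \<open>c\<close>.\<close>

definition channel :: "nat \<Rightarrow> nat \<Rightarrow> real" where
  "channel c c' = Re (dec (received c) $$ (c', c'))"

definition envelope :: "nat \<Rightarrow> real" where
  "envelope c' = Re (dec dominating $$ (c', c'))"

lemma received_carrier: "received c \<in> carrier_mat (t * b) (t * b)"
  using received_psd[of c] by (simp add: pos_semidef_def)

lemma channel_eq: "c' < D \<Longrightarrow> dec (received c) $$ (c', c') = of_real (channel c c')"
  using pos_semidef_diag[OF cptp_positive[OF dec received_psd]]
  by (simp add: channel_def complex_eq_iff less_eq_complex_def)

lemma channel_nonneg: "c' < D \<Longrightarrow> 0 \<le> channel c c'"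
  using pos_semidef_diag[OF cptp_positive[OF dec received_psd]]
  by (simp add: channel_def less_eq_complex_def)

lemma channel_sum:
  assumes "c < D"
  shows "(\<Sum>c'<D. channel c c') = 1"
proof -
  have "complex_of_real (\<Sum>c'<D. channel c c') = mat_trace (dec (received c))"
    using cptp_carrier[OF dec received_carrier, of c] by (simp add: mat_trace_def channel_eq)
  also have "\<dots> = 1"
    by (simp add: cptp_trace[OF dec received_carrier] received_trace assms)
  finally show ?thesis by (metis of_real_eq_1_iff)
qed

text \<open>A positive map is monotone, so the domination of Bob's states passes to his output
  probabilities.\<close>

lemma channel_le_envelope:
  assumes "c < D" "c' < D"
  shows "channel c c' \<le> envelope c'"
proof -
  note psd = received_le_dominating[OF assms(1)]
  have dc: "dominating \<in> carrier_mat (t * b) (t * b)"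
    by (simp add: dominating_def)
  have m: "dominating - received c \<in> carrier_mat (t * b) (t * b)"
    using psd by (simp add: pos_semidef_def)
  have "dominating = received c + (dominating - received c)"
    using dc received_carrier[of c] by (intro eq_matI) auto
  then have "dec dominating = dec (received c) + dec (dominating - received c)"
    using cptp_add[OF dec received_carrier m] by metis
  moreover have "0 \<le> dec (dominating - received c) $$ (c', c')"
    using pos_semidef_diag[OF cptp_positive[OF dec psd] assms(2)] .
  ultimately show ?thesis
    using assms cptp_carrier[OF dec m] cptp_carrier[OF dec received_carrier, of c]
    by (simp add: channel_def envelope_def less_eq_complex_def)
qed

lemma envelope_sum: "(\<Sum>c'<D. envelope c') = real t"
proof -
  have dc: "dominating \<in> carrier_mat (t * b) (t * b)"
    by (simp add: dominating_def)
  have "(\<Sum>c'<D. envelope c') = Re (mat_trace (dec dominating))"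
    using cptp_carrier[OF dec dc] by (simp add: mat_trace_def envelope_def)
  then show ?thesis
    by (simp add: cptp_trace[OF dec dc] dominating_trace)
qed

text \<open>For a fixed value \<open>x\<close> of the reference, the diagonal source gives a
  weighted mixture over \<open>c\<close> of the inputs \<open>input_vec c\<close>, and linearity
  carries the mixture through the encoder.\<close>

lemma lifted_encoder_index:
  assumes I: "I \<in> carrier_mat (K * D) (K * D)"
    and diag: "\<And>i j. i < K * D \<Longrightarrow> j < K * D \<Longrightarrow> I $$ (i, j) = (if i = j then of_real (p i) else 0)"
    and x: "x < K" and u: "u < D * t * b" "u' < D * t * b"
  shows "lift_map K b (D * a) (D * t) enc (tensor_mat I (ket_bra \<theta>)) $$ (x * (D * t * b) + u, x * (D * t * b) + u') =
    (\<Sum>c<D. of_real (p (x * D + c)) * encoded c $$ (u, u'))"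
proof -
  obtain y e y' e' where y: "y < D * t" "e < b" "u = y * b + e" "y' < D * t" "e' < b" "u' = y' * b + e'"
    using u by (metis pair_cases)
  have dim: "dim_row I = K * D" "dim_col I = K * D" "dim_row (ket_bra \<theta>) = a * b" "dim_col (ket_bra \<theta>) = a * b"
    using I \<theta> by (auto simp: ket_bra_def)
  let ?N = "mat (D * a) (D * a) (\<lambda>(i, j). tensor_mat I (ket_bra \<theta>) $$
      (x * (D * a * b) + i * b + e, x * (D * a * b) + j * b + e'))"
  have "?N = mat (D * a) (D * a) (\<lambda>ij. \<Sum>c<D. of_real (p (x * D + c)) * (case ij of (i, j) \<Rightarrow> input_block c e e' $$ (i, j)))"
  proof (rule eq_matI, goal_cases)
    case (1 i j)
    then have ij: "i < D * a" "j < D * a" by auto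
    then obtain z k z' l where z: "z < D" "k < a" "i = z * a + k" "z' < D" "l < a" "j = z' * a + l"
      by (metis pair_cases)
    have lt: "k * b + e < a * b" "l * b + e' < a * b" "x * D + z < K * D" "x * D + z' < K * D"
      using z y x by (auto intro: pair_less)
    have eq: "x * (D * a * b) + i * b + e = (x * D + z) * (a * b) + (k * b + e)"
      "x * (D * a * b) + j * b + e' = (x * D + z') * (a * b) + (l * b + e')"
      by (simp_all add: z algebra_simps)
    have "?N $$ (i, j) = I $$ (x * D + z, x * D + z') * (\<theta> $ (k * b + e) * cnj (\<theta> $ (l * b + e')))"
      using ij lt \<theta> pair_less[OF lt(3) lt(1)] pair_less[OF lt(4) lt(2)]
      by (simp add: eq tensor_mat_def dim) (simp add: ket_bra_def)
    also have "\<dots> = (\<Sum>c<D. if c = z then of_real (p (x * D + c)) * input_block c e e' $$ (i, j) else 0)"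
      using z lt ij by (simp add: diag input_block_def)
    also have "\<dots> = (\<Sum>c<D. of_real (p (x * D + c)) * input_block c e e' $$ (i, j))"
      using z ij by (intro sum.cong refl) (auto simp: input_block_def)
    finally show ?case using ij by simp
  qed auto
  then have "enc ?N $$ (y, y') = (\<Sum>c<D. of_real (p (x * D + c)) * enc (mat (D * a) (D * a) (\<lambda>(i, j). input_block c e e' $$ (i, j))) $$ (y, y'))"
    using cptp_sum[OF enc, of "{..<D}" y y'] y by simp
  also have "\<dots> = (\<Sum>c<D. of_real (p (x * D + c)) * encoded c $$ (u, u'))"
  proof (intro sum.cong refl)
    fix c
    have "mat (D * a) (D * a) (\<lambda>(i, j). input_block c e e' $$ (i, j)) = input_block c e e'"
      using input_block_carrier[of c e e'] by (intro eq_matI) auto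
    then show "of_real (p (x * D + c)) * enc (mat (D * a) (D * a) (\<lambda>(i, j). input_block c e e' $$ (i, j))) $$ (y, y') =
        of_real (p (x * D + c)) * encoded c $$ (u, u')"
      using y by (simp add: encoded_index)
  qed
  finally have "enc ?N $$ (y, y') = \<dots>" .
  moreover have "x * (D * t * b) + u < K * (D * t) * b" "x * (D * t * b) + u' < K * (D * t) * b"
    using pair_less[OF x u(1)] pair_less[OF x u(2)] by (simp_all add: mult.assoc)
  moreover have "(x * (D * t * b) + u) mod b = e" "(x * (D * t * b) + u') mod b = e'"
    using y by (simp_all flip: mult.assoc add: add.assoc[symmetric] distrib_right[symmetric])
  moreover have "(x * (D * t * b) + u) div b = x * (D * t) + y" "(x * (D * t * b) + u') div b = x * (D * t) + y'"
    using y by (simp_all flip: mult.assoc add: add.assoc[symmetric] distrib_right[symmetric])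
  ultimately show ?thesis
    using y u by (simp add: lift_map_def)
qed

text \<open>The joint law of reference and output is that of the source followed by
  \<open>channel\<close>.\<close>

lemma decoded_index:
  assumes I: "I \<in> carrier_mat (K * D) (K * D)"
    and diag: "\<And>i j. i < K * D \<Longrightarrow> j < K * D \<Longrightarrow> I $$ (i, j) = (if i = j then of_real (p i) else 0)"
    and x: "x < K" and c': "c' < D"
  shows "ptrace_mid K D D (lift_map (K * D) 1 (t * b) D dec
      (lift_map K b (D * a) (D * t) enc (tensor_mat I (ket_bra \<theta>)))) $$ (x * D + c', x * D + c') =
    of_real (\<Sum>c<D. p (x * D + c) * channel c c')"
proof -
  let ?E = "lift_map K b (D * a) (D * t) enc (tensor_mat I (ket_bra \<theta>))"
  let ?B = "\<lambda>c z. mat (t * b) (t * b) (\<lambda>(i, j). encoded c $$ (z * (t * b) + i, z * (t * b) + j))"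
  have block: "lift_map (K * D) 1 (t * b) D dec ?E $$ (x * (D * D) + z * D + c', x * (D * D) + z * D + c') =
      (\<Sum>c<D. of_real (p (x * D + c)) * dec (?B c z) $$ (c', c'))" if z: "z < D" for z
  proof -
    have "mat (t * b) (t * b) (\<lambda>(i, j). ?E $$ ((x * D + z) * (t * b) + i, (x * D + z) * (t * b) + j)) =
      mat (t * b) (t * b) (\<lambda>ij. \<Sum>c<D. of_real (p (x * D + c)) *
         (case ij of (i, j) \<Rightarrow> encoded c $$ (z * (t * b) + i, z * (t * b) + j)))"
    proof (rule eq_matI, goal_cases)
      case (1 i j)
      then have ij: "i < t * b" "j < t * b" by auto
      have "(x * D + z) * (t * b) + i = x * (D * t * b) + (z * (t * b) + i)" for i
        by (simp add: algebra_simps)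
      then show ?case
        using ij lifted_encoder_index[OF I diag x, of "z * (t * b) + i" "z * (t * b) + j"]
          pair_less[OF z ij(1)] pair_less[OF z ij(2)] by (simp add: mult.assoc add.assoc)
    qed auto
    then have "dec (mat (t * b) (t * b) (\<lambda>(i, j). ?E $$ ((x * D + z) * (t * b) + i, (x * D + z) * (t * b) + j))) $$ (c', c')
      = (\<Sum>c<D. of_real (p (x * D + c)) * dec (?B c z) $$ (c', c'))"
      using cptp_sum[OF dec, of "{..<D}" c' c'] c' by simp
    moreover have "x * (D * D) + z * D + c' = (x * D + z) * D + c'"
      by (simp add: algebra_simps)
    moreover have "(x * D + z) * D + c' < K * D * D"
      using x z c' by (intro pair_less)
    ultimately show ?thesis
      using c' by (simp add: lift_map_def)
  qed
  \<comment> \<open>The final partial trace removes the copy kept by Alice, here the index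
    \<open>z\<close>. By linearity it can be taken before decoding, where it produces
    \<open>received c\<close>.\<close>
  have dec_sum: "(\<Sum>z<D. dec (?B c z) $$ (c', c')) = of_real (channel c c')" for c
  proof -
    have "mat (t * b) (t * b) (\<lambda>ij. \<Sum>z<D. 1 * (case ij of (i, j) \<Rightarrow> encoded c $$ (z * (t * b) + i, z * (t * b) + j))) = received c"
      by (auto intro!: eq_matI simp: received_def ptrace_mid_def)
    then show ?thesis
      using cptp_sum[OF dec, of "{..<D}" c' c' "\<lambda>_. 1" "\<lambda>z (i, j). encoded c $$ (z * (t * b) + i, z * (t * b) + j)"] c'
      by (simp add: channel_eq)
  qed
  have "x * D + c' < K * D" using x c' by (rule pair_less)
  then have "ptrace_mid K D D (lift_map (K * D) 1 (t * b) D dec ?E) $$ (x * D + c', x * D + c') =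
      (\<Sum>z<D. \<Sum>c<D. of_real (p (x * D + c)) * dec (?B c z) $$ (c', c'))"
    using c' block by (simp add: ptrace_mid_def)
  also have "\<dots> = (\<Sum>c<D. \<Sum>z<D. of_real (p (x * D + c)) * dec (?B c z) $$ (c', c'))"
    by (rule sum.swap)
  also have "\<dots> = (\<Sum>c<D. of_real (p (x * D + c)) * of_real (channel c c'))"
    by (simp add: dec_sum flip: sum_distrib_left)
  finally show ?thesis by simp
qed

end

text \<open>The passage from quantum to classical: the lower bound sees a protocol only through the
  stochastic matrix \<open>W\<close>, its envelope \<open>Q\<close> and the diagonal of the final
  state.\<close>

lemma protocol_channel:
  assumes P: "is_protocol k d \<omega> n R P"
    and diag: "\<And>i j. i < k ^ n * d ^ n \<Longrightarrow> j < k ^ n * d ^ n \<Longrightarrow>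
      iid_state k d n \<omega> $$ (i, j) = (if i = j then of_real (p i) else 0)"
  obtains W Q where
    "\<And>c c'. c' < d ^ n \<Longrightarrow> 0 \<le> W c c'"
    "\<And>c. c < d ^ n \<Longrightarrow> (\<Sum>c'<d ^ n. W c c') = (1 :: real)"
    "\<And>c c'. c < d ^ n \<Longrightarrow> c' < d ^ n \<Longrightarrow> W c c' \<le> Q c'"
    "(\<Sum>c'<d ^ n. Q c') = real (message_size n R)"
    "\<And>x c'. x < k ^ n \<Longrightarrow> c' < d ^ n \<Longrightarrow>
       ptrace_mid (k ^ n) (d ^ n) (d ^ n) (final_state k d \<omega> n R P) $$ (x * d ^ n + c', x * d ^ n + c') =
       of_real (\<Sum>c<d ^ n. p (x * d ^ n + c) * W c c')"
proof -
  interpret ea_code "d ^ n" "message_size n R" "ent_dim_A P" "ent_dim_B P" "ent_state P" "encoder P" "decoder P"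
    using P by unfold_locales (auto simp: is_protocol_def Let_def)
  have "iid_state k d n \<omega> \<in> carrier_mat (k ^ n * d ^ n) (k ^ n * d ^ n)"
    by (simp add: iid_state_def)
  note idx = decoded_index[OF this diag]
  let ?\<tau> = "ptrace_mid (k ^ n) (d ^ n) (d ^ n) (final_state k d \<omega> n R P)"
  have \<tau>: "?\<tau> $$ (x * d ^ n + c', x * d ^ n + c') = of_real (\<Sum>c<d ^ n. p (x * d ^ n + c) * channel c c')"
    if "x < k ^ n" "c' < d ^ n" for x c'
    using idx that unfolding final_state_def encoded_state_def by simp
  show ?thesis
    by (rule that[of channel envelope])
       (use \<tau> in \<open>simp_all add: channel_nonneg channel_sum channel_le_envelope envelope_sum del: of_real_sum\<close>)
qed

section \<open>Single-letter channels of a channel on words\<close>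

abbreviation digit :: "nat \<Rightarrow> nat \<Rightarrow> nat \<Rightarrow> nat" where
  "digit b l i \<equiv> i div b ^ l mod b"

text \<open>The distributive law over all words. Splitting off the least significant digit shifts
  the other positions by one, so \<open>f\<close> has to vary in the induction.\<close>

lemma sum_prod_digit:
  fixes f :: "nat \<Rightarrow> nat \<Rightarrow> 'a :: comm_semiring_1"
  shows "(\<Sum>i<b ^ n. \<Prod>l<n. f l (digit b l i)) = (\<Prod>l<n. \<Sum>a<b. f l a)"
proof (induction n arbitrary: f)
  case (Suc n)
  have "(\<Sum>i<b ^ Suc n. \<Prod>l<Suc n. f l (digit b l i)) =
      (\<Sum>q<b ^ n. \<Sum>r<b. \<Prod>l<Suc n. f l (digit b l (q * b + r)))"
    by (simp only: power_Suc2 sum_pair)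
  also have "\<dots> = (\<Sum>q<b ^ n. \<Sum>r<b. f 0 r * (\<Prod>l<n. f (Suc l) (digit b l q)))"
    unfolding prod.lessThan_Suc_shift by (intro sum.cong refl) (simp add: div_mult2_eq)
  also have "\<dots> = (\<Sum>r<b. f 0 r) * (\<Sum>q<b ^ n. \<Prod>l<n. f (Suc l) (digit b l q))"
    by (subst sum.swap) (simp only: sum_product)
  finally show ?case
    by (simp only: Suc.IH[of "\<lambda>l. f (Suc l)"] prod.lessThan_Suc_shift)
qed simp

lemma digit_inject:
  assumes "i < b ^ n" "j < b ^ n" "\<And>l. l < n \<Longrightarrow> digit b l i = digit b l j"
  shows "i = j"
  using assms
proof (induction n arbitrary: i j)
  case (Suc n)
  have "i div b = j div b"
  proof (rule Suc.IH)
    show "i div b < b ^ n" "j div b < b ^ n"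
      using Suc.prems(1,2) by (simp_all add: less_mult_imp_div_less power_Suc2 del: power_Suc)
    show "digit b l (i div b) = digit b l (j div b)" if "l < n" for l
      using Suc.prems(3)[of "Suc l"] that by (simp add: div_mult2_eq)
  qed
  moreover have "i mod b = j mod b"
    using Suc.prems(3)[of 0] by simp
  ultimately show ?case
    by (metis div_mult_mod_eq)
qed simp

lemma prod_insert_at:
  fixes l n :: nat
  assumes "l < n"
  shows "(\<Prod>m<n. if m = l then u else v m) = u * (\<Prod>m<n. if m = l then 1 else v m :: 'a :: comm_monoid_mult)"
proof -
  have "(\<Prod>m<n. if m = l then u else v m) = (\<Prod>m<n. (if m = l then u else 1) * (if m = l then 1 else v m))"
    by (intro prod.cong) auto
  moreover have "(\<Prod>m<n. if m = l then u else 1) = u"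
    using assms by (subst prod.delta) auto
  ultimately show ?thesis
    by (simp add: prod.distrib)
qed

lemma sum_by_digit:
  assumes "0 < b"
  shows "(\<Sum>i\<in>A. F i) = (\<Sum>a<b. \<Sum>i\<in>A. if digit b l i = a then F i else (0 :: 'a :: comm_monoid_add))"
  using assms by (subst sum.swap) simp

text \<open>\<omega> is the joint law of a single pair of reference and letter, whereas
  \<open>W\<close> acts on whole words and may correlate their letters arbitrarily.\<close>

locale iid_channel =
  fixes k d n :: nat and \<omega> W :: "nat \<Rightarrow> nat \<Rightarrow> real"
  assumes d_pos: "0 < d"
    and \<omega>_nonneg: "\<And>x c. 0 \<le> \<omega> x c"
    and \<omega>_sum: "(\<Sum>c<d. \<Sum>x<k. \<omega> x c) = 1"
    and W_nonneg: "\<And>c c'. c' < d ^ n \<Longrightarrow> 0 \<le> W c c'"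
    and W_sum: "\<And>c. c < d ^ n \<Longrightarrow> (\<Sum>c'<d ^ n. W c c') = 1"
begin

definition \<pi> :: "nat \<Rightarrow> real" where
  "\<pi> c = (\<Sum>x<k. \<omega> x c)"

lemma \<pi>_nonneg: "0 \<le> \<pi> c"
  unfolding \<pi>_def by (intro sum_nonneg \<omega>_nonneg)

lemma \<pi>_sum: "(\<Sum>c<d. \<pi> c) = 1"
  using \<omega>_sum by (simp add: \<pi>_def)

definition rest :: "nat \<Rightarrow> nat \<Rightarrow> real" where
  "rest l c = (\<Prod>m<n. if m = l then 1 else \<pi> (digit d m c))"

definition joint :: "nat \<Rightarrow> nat \<Rightarrow> real" where
  "joint c c' = (\<Prod>m<n. \<pi> (digit d m c)) * W c c'"

text \<open>The law of the output letter \<open>l\<close> given the input letter \<open>a\<close> at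
  that position, the other letters being drawn from \<pi>. Weighting by \<open>rest\<close> is
  conditioning without a division by \<open>\<pi> a\<close>.\<close>

definition letter_channel :: "nat \<Rightarrow> nat \<Rightarrow> nat \<Rightarrow> real" where
  "letter_channel l a a' = (\<Sum>c<d ^ n. if digit d l c = a then
     rest l c * (\<Sum>c'<d ^ n. if digit d l c' = a' then W c c' else 0) else 0)"

lemma letter_channel_nonneg: "0 \<le> letter_channel l a a'"
proof -
  have "0 \<le> rest l c" for c
    unfolding rest_def by (intro prod_nonneg) (simp add: \<pi>_nonneg)
  moreover have "0 \<le> (\<Sum>c'<d ^ n. if digit d l c' = a' then W c c' else 0)" for c
    by (intro sum_nonneg) (simp add: W_nonneg)
  ultimately show ?thesis
    unfolding letter_channel_def by (intro sum_nonneg) simp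
qed

lemma letter_channel_sum:
  assumes "l < n" "a < d"
  shows "(\<Sum>a'<d. letter_channel l a a') = 1"
proof -
  have "(\<Sum>a'<d. letter_channel l a a') = (\<Sum>c<d ^ n. \<Sum>a'<d. if digit d l c = a then
     rest l c * (\<Sum>c'<d ^ n. if digit d l c' = a' then W c c' else 0) else 0)"
    unfolding letter_channel_def by (rule sum.swap)
  also have "\<dots> = (\<Sum>c<d ^ n. if digit d l c = a then rest l c else 0)"
  proof (rule sum.cong[OF refl])
    fix c assume "c \<in> {..<d ^ n}"
    then have "(\<Sum>a'<d. \<Sum>c'<d ^ n. if digit d l c' = a' then W c c' else 0) = 1"
      using sum_by_digit[OF d_pos, where F = "W c" and A = "{..<d ^ n}" and l = l] W_sum[of c] by simp
    then show "(\<Sum>a'<d. if digit d l c = a then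
        rest l c * (\<Sum>c'<d ^ n. if digit d l c' = a' then W c c' else 0) else 0) =
        (if digit d l c = a then rest l c else 0)"
      by (cases "digit d l c = a") (simp_all flip: sum_distrib_left)
  qed
  \<comment> \<open>The condition on letter \<open>l\<close> is turned into an indicator inside the
    \<open>l\<close>-th factor, so that the sum over words factorises.\<close>
  also have "\<dots> = (\<Sum>c<d ^ n. \<Prod>m<n. (\<lambda>b. if m = l then if b = a then 1 else 0 else \<pi> b) (digit d m c))"
  proof (intro sum.cong refl)
    fix c
    show "(if digit d l c = a then rest l c else 0) =
        (\<Prod>m<n. (\<lambda>b. if m = l then if b = a then 1 else 0 else \<pi> b) (digit d m c))"
    proof (cases "digit d l c = a")
      case True
      then show ?thesis by (auto simp: rest_def intro!: prod.cong)
    next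
      case False
      then show ?thesis using assms by (auto intro!: prod_zero[symmetric] bexI[of _ l])
    qed
  qed
  also have "\<dots> = (\<Prod>m<n. \<Sum>b<d. if m = l then if b = a then 1 else 0 else \<pi> b)"
    by (rule sum_prod_digit)
  also have "\<dots> = (\<Prod>m<n. 1)"
    using assms by (intro prod.cong refl) (simp add: \<pi>_sum sum_if)
  finally show ?thesis by simp
qed

text \<open>The channel does not see the reference, so summing out the reference letters at the
  other positions turns their \<omega> into \<pi>. What remains is pair \<open>l\<close> passed
  through one channel that is the same for every \<open>x0\<close>.\<close>

lemma letter_channel_marginal:
  assumes l: "l < n" and x0: "x0 < k"
  shows "(\<Sum>x<k ^ n. \<Sum>c'<d ^ n. if digit k l x = x0 \<and> digit d l c' = a' then
      \<Sum>c<d ^ n. (\<Prod>m<n. \<omega> (digit k m x) (digit d m c)) * W c c' else 0) =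
    (\<Sum>a<d. \<omega> x0 a * letter_channel l a a')"
proof -
  let ?W = "\<lambda>c. \<Sum>c'<d ^ n. if digit d l c' = a' then W c c' else 0"
  let ?p = "\<lambda>x c. \<Prod>m<n. \<omega> (digit k m x) (digit d m c)"
  have "(\<Sum>x<k ^ n. \<Sum>c'<d ^ n. if digit k l x = x0 \<and> digit d l c' = a' then \<Sum>c<d ^ n. ?p x c * W c c' else 0)
    = (\<Sum>x<k ^ n. \<Sum>c'<d ^ n. \<Sum>c<d ^ n. (if digit k l x = x0 then ?p x c else 0) * (if digit d l c' = a' then W c c' else 0))"
    by (intro sum.cong refl) auto
  also have "\<dots> = (\<Sum>x<k ^ n. \<Sum>c<d ^ n. \<Sum>c'<d ^ n. (if digit k l x = x0 then ?p x c else 0) * (if digit d l c' = a' then W c c' else 0))"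
    by (intro sum.cong refl sum.swap)
  also have "\<dots> = (\<Sum>c<d ^ n. \<Sum>x<k ^ n. \<Sum>c'<d ^ n. (if digit k l x = x0 then ?p x c else 0) * (if digit d l c' = a' then W c c' else 0))"
    by (rule sum.swap)
  also have "\<dots> = (\<Sum>c<d ^ n. (\<Sum>x<k ^ n. if digit k l x = x0 then ?p x c else 0) * ?W c)"
    by (simp only: sum_product)
  also have "\<dots> = (\<Sum>c<d ^ n. \<omega> x0 (digit d l c) * (rest l c * ?W c))"
  proof (intro sum.cong refl)
    fix c
    have "(if digit k l x = x0 then ?p x c else 0) =
      (\<Prod>m<n. (\<lambda>y. if m = l then if y = x0 then \<omega> x0 (digit d m c) else 0 else \<omega> y (digit d m c)) (digit k m x))" for x
    proof (cases "digit k l x = x0")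
      case True
      then show ?thesis by (auto intro!: prod.cong)
    next
      case False
      then show ?thesis using l by (auto intro!: prod_zero[symmetric] bexI[of _ l])
    qed
    then have "(\<Sum>x<k ^ n. if digit k l x = x0 then ?p x c else 0) =
       (\<Prod>m<n. \<Sum>y<k. if m = l then if y = x0 then \<omega> x0 (digit d m c) else 0 else \<omega> y (digit d m c))"
      using sum_prod_digit[where n = n and b = k and f = "\<lambda>m y. if m = l then if y = x0 then \<omega> x0 (digit d m c) else 0 else \<omega> y (digit d m c)"]
      by simp
    also have "\<dots> = (\<Prod>m<n. if m = l then \<omega> x0 (digit d l c) else \<pi> (digit d m c))"
      using x0 by (intro prod.cong refl) (simp add: \<pi>_def sum_if)
    also have "\<dots> = \<omega> x0 (digit d l c) * rest l c"
      unfolding rest_def by (rule prod_insert_at[OF l])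
    finally show "(\<Sum>x<k ^ n. if digit k l x = x0 then ?p x c else 0) * ?W c = \<omega> x0 (digit d l c) * (rest l c * ?W c)"
      by simp
  qed
  also have "\<dots> = (\<Sum>a<d. \<Sum>c<d ^ n. if digit d l c = a then \<omega> x0 (digit d l c) * (rest l c * ?W c) else 0)"
    by (rule sum_by_digit[OF d_pos])
  also have "\<dots> = (\<Sum>a<d. \<omega> x0 a * letter_channel l a a')"
  proof (rule sum.cong[OF refl])
    fix a
    show "(\<Sum>c<d ^ n. if digit d l c = a then \<omega> x0 (digit d l c) * (rest l c * ?W c) else 0) =
        \<omega> x0 a * letter_channel l a a'"
      unfolding letter_channel_def by (subst sum_distrib_left) (auto intro!: sum.cong)
  qed
  finally show ?thesis .
qed

section \<open>The number of agreements and its moments\<close>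

definition agreements :: "nat \<Rightarrow> nat \<Rightarrow> real" where
  "agreements c c' = (\<Sum>l<n. if digit d l c = digit d l c' then 1 else 0)"

lemma joint_nonneg: "c' < d ^ n \<Longrightarrow> 0 \<le> joint c c'"
  unfolding joint_def by (intro mult_nonneg_nonneg prod_nonneg W_nonneg) (auto simp: \<pi>_nonneg)

lemma joint_sum: "(\<Sum>c<d ^ n. \<Sum>c'<d ^ n. joint c c') = 1"
  using sum_prod_digit[where n = n and b = d and f = "\<lambda>_. \<pi>"] by (simp add: joint_def W_sum \<pi>_sum flip: sum_distrib_left)

text \<open>Linearity of expectation, valid however the letters are correlated.\<close>

lemma expected_agreements:
  "(\<Sum>c<d ^ n. \<Sum>c'<d ^ n. joint c c' * agreements c c') = (\<Sum>l<n. \<Sum>a<d. \<pi> a * letter_channel l a a)"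
proof -
  let ?e = "\<lambda>l c c'. if digit d l c = digit d l c' then 1 else 0 :: real"
  have "(\<Sum>c<d ^ n. \<Sum>c'<d ^ n. joint c c' * agreements c c') =
     (\<Sum>c<d ^ n. \<Sum>c'<d ^ n. \<Sum>l<n. joint c c' * ?e l c c')"
    by (simp add: agreements_def sum_distrib_left)
  also have "\<dots> = (\<Sum>c<d ^ n. \<Sum>l<n. \<Sum>c'<d ^ n. joint c c' * ?e l c c')"
    by (intro sum.cong refl sum.swap)
  also have "\<dots> = (\<Sum>l<n. \<Sum>c<d ^ n. \<Sum>c'<d ^ n. joint c c' * ?e l c c')"
    by (rule sum.swap)
  also have "\<dots> = (\<Sum>l<n. \<Sum>a<d. \<pi> a * letter_channel l a a)"
  proof (rule sum.cong[OF refl])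
    fix l assume "l \<in> {..<n}"
    then have l: "l < n" by simp
    have p: "(\<Prod>m<n. \<pi> (digit d m c)) = \<pi> (digit d l c) * rest l c" for c
    proof -
      have "(\<Prod>m<n. \<pi> (digit d m c)) = (\<Prod>m<n. if m = l then \<pi> (digit d l c) else \<pi> (digit d m c))"
        by (intro prod.cong) auto
      also have "\<dots> = \<pi> (digit d l c) * rest l c"
        unfolding rest_def by (rule prod_insert_at[OF l])
      finally show ?thesis .
    qed
    have "(\<Sum>c<d ^ n. \<Sum>c'<d ^ n. joint c c' * ?e l c c') =
      (\<Sum>a<d. \<Sum>c<d ^ n. if digit d l c = a then \<Sum>c'<d ^ n. joint c c' * ?e l c c' else 0)"
      by (rule sum_by_digit[OF d_pos])
    also have "\<dots> = (\<Sum>a<d. \<pi> a * letter_channel l a a)"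
    proof (rule sum.cong[OF refl])
      fix a
      have "(\<Sum>c'<d ^ n. joint c c' * ?e l c c') =
          \<pi> a * (rest l c * (\<Sum>c'<d ^ n. if digit d l c' = a then W c c' else 0))" if "digit d l c = a" for c
        unfolding sum_distrib_left using that by (intro sum.cong refl) (auto simp: joint_def p)
      then show "(\<Sum>c<d ^ n. if digit d l c = a then \<Sum>c'<d ^ n. joint c c' * ?e l c c' else 0) =
          \<pi> a * letter_channel l a a"
        unfolding letter_channel_def by (subst sum_distrib_left) (auto intro!: sum.cong)
    qed
    finally show "(\<Sum>c<d ^ n. \<Sum>c'<d ^ n. joint c c' * ?e l c c') = (\<Sum>a<d. \<pi> a * letter_channel l a a)" .
  qed
  finally show ?thesis .
qed

text \<open>The exponential moment of the number of agreements is large because the channel reproduces most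
  letters, and small because the channel output is dominated by a law that is independent of the
  input. Its lower bound is Jensen's inequality.\<close>

lemma agreements_bound:
  assumes d: "2 \<le> d"
    and \<pi>_le: "\<And>a. a < d \<Longrightarrow> \<pi> a \<le> 2 / d"
    and agree: "\<And>l. l < n \<Longrightarrow> 1 - \<delta> \<le> (\<Sum>a<d. \<pi> a * letter_channel l a a)"
    and Q: "\<And>c c'. c < d ^ n \<Longrightarrow> c' < d ^ n \<Longrightarrow> W c c' \<le> Q c'"
    and Q_sum: "(\<Sum>c'<d ^ n. Q c') = T"
  shows "exp (real n * (1 - \<delta>) * ln d) \<le> T * 3 ^ n"
proof -
  define E where "E = (\<Sum>c<d ^ n. \<Sum>c'<d ^ n. joint c c' * agreements c c')"
  have lnd: "0 \<le> ln (real d)" using d by simp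
  have Q_nonneg: "0 \<le> Q c'" if "c' < d ^ n" for c'
    using W_nonneg[OF that, of 0] Q[of 0 c'] that d_pos by force
  have "real n * (1 - \<delta>) \<le> E"
    using sum_mono[of "{..<n}" "\<lambda>_. 1 - \<delta>" "\<lambda>l. \<Sum>a<d. \<pi> a * letter_channel l a a"] agree
    by (simp add: E_def expected_agreements)
  then have "exp (real n * (1 - \<delta>) * ln d) \<le> exp (E * ln d)"
    using lnd by (simp add: mult_right_mono)
  \<comment> \<open>The inserted factor is an expectation equal to 1, as the deviation from the mean
    averages to 0. It is the tangent line of the exponential at the mean, which lies below the
    curve.\<close>
  also have "\<dots> = exp (E * ln d) * (\<Sum>c<d ^ n. \<Sum>c'<d ^ n. joint c c' * (1 + (agreements c c' * ln d - E * ln d)))"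
  proof -
    have "(\<Sum>c<d ^ n. \<Sum>c'<d ^ n. joint c c' * (1 + (agreements c c' * ln d - E * ln d))) =
      (\<Sum>c<d ^ n. \<Sum>c'<d ^ n. joint c c' * (1 - E * ln d) + (joint c c' * agreements c c') * ln d)"
      by (intro sum.cong refl) (simp add: algebra_simps)
    also have "\<dots> = (\<Sum>c<d ^ n. \<Sum>c'<d ^ n. joint c c') * (1 - E * ln d) + E * ln d"
      by (simp only: E_def sum.distrib sum_distrib_right)
    also have "\<dots> = 1"
      by (simp add: joint_sum)
    finally show ?thesis by simp
  qed
  also have "\<dots> \<le> exp (E * ln d) * (\<Sum>c<d ^ n. \<Sum>c'<d ^ n. joint c c' * exp (agreements c c' * ln d - E * ln d))"
    by (intro mult_left_mono sum_mono exp_ge_add_one_self joint_nonneg) auto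
  also have "\<dots> = (\<Sum>c<d ^ n. \<Sum>c'<d ^ n. joint c c' * exp (agreements c c' * ln d))"
    by (simp add: sum_distrib_left exp_diff)
  also have "\<dots> = (\<Sum>c<d ^ n. \<Sum>c'<d ^ n. W c c' *
      (\<Prod>l<n. \<pi> (digit d l c) * (if digit d l c = digit d l c' then real d else 1)))"
  proof (intro sum.cong refl)
    fix c c'
    have "exp (agreements c c' * ln d) = (\<Prod>l<n. if digit d l c = digit d l c' then real d else 1)"
      unfolding agreements_def sum_distrib_right exp_sum[OF finite_lessThan]
      using d by (intro prod.cong) auto
    then show "joint c c' * exp (agreements c c' * ln d) = W c c' *
      (\<Prod>l<n. \<pi> (digit d l c) * (if digit d l c = digit d l c' then real d else 1))"
      by (simp add: joint_def prod.distrib)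
  qed
  \<comment> \<open>With \<open>Q\<close> in place of \<open>W\<close> the output no longer depends
    on the input, so for fixed \<open>c'\<close> the sum over \<open>c\<close> becomes a product
    over the letters.\<close>
  also have "\<dots> \<le> (\<Sum>c<d ^ n. \<Sum>c'<d ^ n. Q c' *
      (\<Prod>l<n. \<pi> (digit d l c) * (if digit d l c = digit d l c' then real d else 1)))"
    by (intro sum_mono mult_right_mono Q prod_nonneg) (auto simp: \<pi>_nonneg)
  also have "\<dots> = (\<Sum>c'<d ^ n. Q c' * (\<Sum>c<d ^ n.
      \<Prod>l<n. \<pi> (digit d l c) * (if digit d l c = digit d l c' then real d else 1)))"
    by (subst sum.swap) (simp add: sum_distrib_left)
  also have "\<dots> \<le> (\<Sum>c'<d ^ n. Q c' * 3 ^ n)"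
  proof (intro sum_mono mult_left_mono)
    fix c'
    have "(\<Sum>c<d ^ n. \<Prod>l<n. \<pi> (digit d l c) * (if digit d l c = digit d l c' then real d else 1)) =
      (\<Prod>l<n. \<Sum>a<d. \<pi> a * (if a = digit d l c' then real d else 1))"
      by (rule sum_prod_digit[where n = n and b = d and f = "\<lambda>l a. \<pi> a * (if a = digit d l c' then real d else 1)"])
    also have "\<dots> \<le> (\<Prod>l<n. 3)"
    proof (intro prod_mono conjI sum_nonneg)
      fix l
      define b where "b = digit d l c'"
      have b: "b < d" using d_pos by (simp add: b_def)
      \<comment> \<open>The source of the base 3: a miss contributes at most 1 in total, and a hit
        gains at most \<open>(2 / d) * d = 2\<close>.\<close>
      have "(\<Sum>a<d. \<pi> a * (if a = b then real d else 1)) = (\<Sum>a<d. \<pi> a + (if a = b then \<pi> a * (real d - 1) else 0))"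
        by (intro sum.cong) (auto simp: algebra_simps)
      also have "\<dots> = 1 + \<pi> b * (real d - 1)"
        using b by (simp add: sum.distrib \<pi>_sum)
      also have "\<pi> b * (real d - 1) \<le> (2 / d) * d"
        using \<pi>_le[OF b] d by (intro mult_mono) auto
      finally show "(\<Sum>a<d. \<pi> a * (if a = digit d l c' then real d else 1)) \<le> 3"
        using d by (simp add: b_def)
    qed (auto simp: \<pi>_nonneg)
    finally show "(\<Sum>c<d ^ n. \<Prod>l<n. \<pi> (digit d l c) * (if digit d l c = digit d l c' then real d else 1)) \<le> 3 ^ n"
      by simp
  qed (auto simp: Q_nonneg)
  finally show ?thesis
    by (simp add: Q_sum flip: sum_distrib_right)
qed

end

lemma mult_le_abs:
  fixes x y z :: real
  assumes "0 \<le> x" "x \<le> y"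
  shows "x * z \<le> y * \<bar>z\<bar>"
proof -
  have "x * z \<le> x * \<bar>z\<bar>" using assms(1) by (intro mult_left_mono) auto
  also have "\<dots> \<le> y * \<bar>z\<bar>" using assms(2) by (intro mult_right_mono) auto
  finally show ?thesis .
qed

text \<open>Approximate preservation of the uniform and of the linear law fixes the second moment of the
  displacement \<open>h a - h a'\<close>, where \<open>h a = d - a\<close>: only the first moment \<open>\<Sum>a. h a * V a a'\<close> and the
  column sums of \<open>V\<close> enter it.\<close>

lemma linear_law_rigidity:
  fixes V :: "nat \<Rightarrow> nat \<Rightarrow> real"
  assumes V_nonneg: "\<And>a a'. 0 \<le> V a a'"
    and V_sum: "\<And>a. a < d \<Longrightarrow> (\<Sum>a'<d. V a a') = 1"
    and d: "0 < d"
    and err: "(\<Sum>a'<d. \<bar>(\<Sum>a<d. 1 / (2 * d) * V a a') - 1 / (2 * d)\<bar>) +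
      (\<Sum>a'<d. \<bar>(\<Sum>a<d. real (d - a) / (d * (real d + 1)) * V a a') - real (d - a') / (d * (real d + 1))\<bar>) \<le> e"
  shows "(\<Sum>a<d. 1 - V a a) \<le> 2 * real d ^ 2 * (real d + 1) * e"
proof -
  define h where "h a = real (d - a)" for a
  \<comment> \<open>The weights contain the factor 1/2 from the equiprobable reference;
    \<open>f0\<close> and \<open>f1\<close> are the deviations for the two states.\<close>
  define f0 where "f0 a' = (\<Sum>a<d. 1 / (2 * d) * V a a') - 1 / (2 * d)" for a'
  define f1 where "f1 a' = (\<Sum>a<d. h a / (d * (real d + 1)) * V a a') - h a' / (d * (real d + 1))" for a'
  have h: "0 \<le> h a" "h a \<le> d" for a by (auto simp: h_def)
  have col: "(\<Sum>a<d. V a a') = 1 + 2 * d * f0 a'" for a'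
    using d by (simp add: f0_def field_simps flip: sum_divide_distrib)
  have moment: "(\<Sum>a<d. h a * V a a') = h a' + d * (real d + 1) * f1 a'" for a'
  proof -
    have "(\<Sum>a<d. h a / (d * (real d + 1)) * V a a') = (\<Sum>a<d. h a * V a a') / (d * (real d + 1))"
      by (simp add: sum_divide_distrib)
    then show ?thesis
      using d by (simp add: f1_def right_diff_distrib)
  qed
  have "(\<Sum>a<d. 1 - V a a) = (\<Sum>a<d. \<Sum>a'\<in>{..<d} - {a}. V a a')"
  proof (intro sum.cong refl)
    fix a assume "a \<in> {..<d}"
    then show "1 - V a a = (\<Sum>a'\<in>{..<d} - {a}. V a a')"
      using V_sum[of a] sum.remove[of "{..<d}" a "V a"] by simp
  qed
  also have "\<dots> \<le> (\<Sum>a<d. \<Sum>a'\<in>{..<d} - {a}. V a a' * (h a - h a')\<^sup>2)"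
  proof (intro sum_mono)
    fix a a' assume a: "a \<in> {..<d}" "a' \<in> {..<d} - {a}"
    \<comment> \<open>\<open>h\<close> takes distinct integer values on distinct letters.\<close>
    have "1 \<le> \<bar>h a - h a'\<bar>"
      using a by (auto simp: h_def of_nat_diff)
    then have "1 \<le> (h a - h a')\<^sup>2"
      by (simp add: abs_le_square_iff[of 1, simplified])
    then show "V a a' \<le> V a a' * (h a - h a')\<^sup>2"
      using V_nonneg[of a a'] by (simp add: mult_le_cancel_left1)
  qed
  also have "\<dots> \<le> (\<Sum>a<d. \<Sum>a'<d. V a a' * (h a - h a')\<^sup>2)"
    by (intro sum_mono sum_mono2) (auto simp: V_nonneg)
  also have "\<dots> = (\<Sum>a<d. \<Sum>a'<d. (h a)\<^sup>2 * V a a' + ((h a')\<^sup>2 * V a a' - 2 * h a' * (h a * V a a')))"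
    by (intro sum.cong refl) (simp add: algebra_simps power2_eq_square)
  also have "\<dots> = (\<Sum>a<d. \<Sum>a'<d. (h a)\<^sup>2 * V a a') + (\<Sum>a<d. \<Sum>a'<d. (h a')\<^sup>2 * V a a' - 2 * h a' * (h a * V a a'))"
    by (simp only: sum.distrib)
  also have "(\<Sum>a<d. \<Sum>a'<d. (h a)\<^sup>2 * V a a') = (\<Sum>a<d. (h a)\<^sup>2)"
    by (simp add: V_sum flip: sum_distrib_left)
  also have "(\<Sum>a<d. \<Sum>a'<d. (h a')\<^sup>2 * V a a' - 2 * h a' * (h a * V a a')) =
      (\<Sum>a'<d. (h a')\<^sup>2 * (1 + 2 * d * f0 a') - 2 * h a' * (h a' + d * (real d + 1) * f1 a'))"
    by (subst sum.swap) (simp add: sum_subtractf col moment flip: sum_distrib_left)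
  \<comment> \<open>The main terms cancel as h^2 + h^2 - 2 h^2 = 0, so the displacement is linear in
    the deviations.\<close>
  also have "(\<Sum>a<d. (h a)\<^sup>2) + \<dots> = (\<Sum>a'<d. 2 * d * (h a')\<^sup>2 * f0 a' - 2 * d * (real d + 1) * h a' * f1 a')"
    unfolding sum.distrib[symmetric] by (intro sum.cong refl) (simp add: algebra_simps power2_eq_square)
  also have "\<dots> \<le> (\<Sum>a'<d. 2 * real d ^ 2 * (real d + 1) * \<bar>f0 a'\<bar> + 2 * real d ^ 2 * (real d + 1) * \<bar>f1 a'\<bar>)"
  proof (intro sum_mono)
    fix a'
    \<comment> \<open>A crude bound, chosen so that both deviations get the same coefficient and
      only their sum matters.\<close>
    have "(h a')\<^sup>2 \<le> d * (real d + 1)"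
      using mult_mono[OF h(2) h(2), of a' a'] h(1)[of a'] by (simp add: power2_eq_square algebra_simps)
    then have "(2 * d * (h a')\<^sup>2) * f0 a' \<le> (2 * d * (d * (real d + 1))) * \<bar>f0 a'\<bar>"
      by (intro mult_le_abs mult_left_mono) auto
    moreover have "(2 * d * (real d + 1) * h a') * (- f1 a') \<le> (2 * d * (real d + 1) * d) * \<bar>- f1 a'\<bar>"
      using h[of a'] by (intro mult_le_abs mult_left_mono) auto
    ultimately show "2 * d * (h a')\<^sup>2 * f0 a' - 2 * d * (real d + 1) * h a' * f1 a' \<le>
        2 * real d ^ 2 * (real d + 1) * \<bar>f0 a'\<bar> + 2 * real d ^ 2 * (real d + 1) * \<bar>f1 a'\<bar>"
      by (simp add: power2_eq_square algebra_simps)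
  qed
  also have "\<dots> = 2 * real d ^ 2 * (real d + 1) * ((\<Sum>a'<d. \<bar>f0 a'\<bar>) + (\<Sum>a'<d. \<bar>f1 a'\<bar>))"
    by (simp only: sum.distrib distrib_left sum_distrib_left)
  also have "\<dots> \<le> 2 * real d ^ 2 * (real d + 1) * e"
    using err by (intro mult_left_mono) (auto simp: f0_def f1_def h_def)
  finally show ?thesis .
qed

section \<open>Diagonal states and their marginals\<close>

definition diag_state :: "nat \<Rightarrow> complex mat \<Rightarrow> (nat \<Rightarrow> real) \<Rightarrow> bool" where
  "diag_state m A p \<longleftrightarrow> A \<in> carrier_mat m m \<and>
     (\<forall>i<m. \<forall>j<m. A $$ (i, j) = (if i = j then of_real (p i) else 0))"

lemma diag_stateD:
  assumes "diag_state m A p"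
  shows "A \<in> carrier_mat m m"
    and "i < m \<Longrightarrow> j < m \<Longrightarrow> A $$ (i, j) = (if i = j then of_real (p i) else 0)"
  using assms by (auto simp: diag_state_def)

lemma digit_less: "i < b ^ n \<Longrightarrow> l < n \<Longrightarrow> digit b l i < b"
  by (cases b; cases n) auto

lemma pair_index_pair:
  "c < d ^ n \<Longrightarrow> pair_index k d n l (x * d ^ n + c) = digit k l x * d + digit d l c"
  by (simp add: pair_index_def)

lemma pair_index_less:
  assumes "i < k ^ n * d ^ n" "l < n"
  shows "pair_index k d n l i < k * d"
proof -
  obtain x c where "x < k ^ n" "c < d ^ n" "i = x * d ^ n + c"
    using assms(1) by (rule pair_cases)
  then show ?thesis
    using assms(2) by (simp add: pair_index_pair pair_less digit_less)
qed

lemma pair_index_inject: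
  assumes "i < k ^ n * d ^ n" "j < k ^ n * d ^ n"
    and eq: "\<And>l. l < n \<Longrightarrow> pair_index k d n l i = pair_index k d n l j"
  shows "i = j"
proof -
  obtain x c where i: "x < k ^ n" "c < d ^ n" "i = x * d ^ n + c"
    using assms(1) by (rule pair_cases)
  obtain y e where j: "y < k ^ n" "e < d ^ n" "j = y * d ^ n + e"
    using assms(2) by (rule pair_cases)
  have "digit k l x = digit k l y \<and> digit d l c = digit d l e" if l: "l < n" for l
  proof -
    have "digit k l x * d + digit d l c = digit k l y * d + digit d l e"
      using eq[OF l] i j by (simp add: pair_index_pair)
    then show ?thesis
      using div_pair[OF digit_less[OF i(2) l]] div_pair[OF digit_less[OF j(2) l]]
        mod_pair[OF digit_less[OF i(2) l]] mod_pair[OF digit_less[OF j(2) l]] by metis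
  qed
  then show ?thesis
    using digit_inject[OF i(1) j(1)] digit_inject[OF i(2) j(2)] i(3) j(3) by blast
qed

lemma iid_state_diag:
  assumes \<omega>: "diag_state (k * d) \<omega> w"
  shows "diag_state (k ^ n * d ^ n) (iid_state k d n \<omega>) (\<lambda>i. \<Prod>l<n. w (pair_index k d n l i))"
proof -
  have "(\<Prod>l<n. \<omega> $$ (pair_index k d n l i, pair_index k d n l j)) =
      (if i = j then of_real (\<Prod>l<n. w (pair_index k d n l i)) else 0)"
    if ij: "i < k ^ n * d ^ n" "j < k ^ n * d ^ n" for i j
  proof (cases "i = j")
    case True
    then show ?thesis
      using ij by (simp add: diag_stateD(2)[OF \<omega>] pair_index_less)
  next
    case False
    then obtain l where "l < n" "pair_index k d n l i \<noteq> pair_index k d n l j"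
      using pair_index_inject[OF ij] by blast
    then show ?thesis
      using False ij by (auto simp: diag_stateD(2)[OF \<omega>] pair_index_less intro!: prod_zero bexI[of _ l])
  qed
  then show ?thesis
    by (simp add: diag_state_def iid_state_def)
qed

text \<open>On the diagonal the two indices agree at every position and hence coincide, so the
  diagonal of the marginal is the classical marginal of the diagonal of \<open>M\<close>, even when
  \<open>M\<close> is not diagonal. That case covers the final state of a protocol.\<close>

lemma pair_marginal_index:
  assumes "a < k * d" "b < k * d" "l < n"
    and off: "a \<noteq> b \<Longrightarrow> \<forall>i<k ^ n * d ^ n. \<forall>j<k ^ n * d ^ n. i \<noteq> j \<longrightarrow> M $$ (i, j) = 0"
  shows "pair_marginal k d n l M $$ (a, b) =
    (if a = b then \<Sum>i<k ^ n * d ^ n. if pair_index k d n l i = a then M $$ (i, i) else 0 else 0)"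
proof -
  let ?S = "{(i, j). i < k ^ n * d ^ n \<and> j < k ^ n * d ^ n \<and> pair_index k d n l i = a \<and> pair_index k d n l j = b \<and>
                   (\<forall>m<n. m \<noteq> l \<longrightarrow> pair_index k d n m i = pair_index k d n m j)}"
  have *: "pair_marginal k d n l M $$ (a, b) = (\<Sum>(i, j)\<in>?S. M $$ (i, j))"
    using assms by (simp add: pair_marginal_def)
  show ?thesis
  proof (cases "a = b")
    case False
    then show ?thesis
      unfolding * using off by (auto intro!: sum.neutral)
  next
    case True
    have "?S = (\<lambda>i. (i, i)) ` {i\<in>{..<k ^ n * d ^ n}. pair_index k d n l i = a}"
    proof (intro equalityI subsetI)
      fix p assume "p \<in> ?S"
      then obtain i j where p: "p = (i, j)" "i < k ^ n * d ^ n" "j < k ^ n * d ^ n"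
        "pair_index k d n l i = a" "pair_index k d n l j = b"
        "\<And>m. m < n \<Longrightarrow> m \<noteq> l \<Longrightarrow> pair_index k d n m i = pair_index k d n m j" by auto
      have "i = j"
        by (rule pair_index_inject[OF p(2,3)]) (use p True in metis)
      then show "p \<in> (\<lambda>i. (i, i)) ` {i\<in>{..<k ^ n * d ^ n}. pair_index k d n l i = a}"
        using p by auto
    qed (use True in auto)
    then have "(\<Sum>(i, j)\<in>?S. M $$ (i, j)) = (\<Sum>i\<in>{i\<in>{..<k ^ n * d ^ n}. pair_index k d n l i = a}. M $$ (i, i))"
      by (simp add: sum.reindex inj_on_def)
    also have "\<dots> = (\<Sum>i<k ^ n * d ^ n. if pair_index k d n l i = a then M $$ (i, i) else 0)"
      by (rule sum.inter_filter) simp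
    finally show ?thesis
      unfolding * using True by simp
  qed
qed

lemma sum_pair_index:
  fixes F :: "nat \<Rightarrow> 'a :: comm_monoid_add"
  assumes "x0 < k" "a' < d" "l < n"
  shows "(\<Sum>i<k ^ n * d ^ n. if pair_index k d n l i = x0 * d + a' then F i else 0) =
    (\<Sum>x<k ^ n. \<Sum>c<d ^ n. if digit k l x = x0 \<and> digit d l c = a' then F (x * d ^ n + c) else 0)"
proof -
  have "pair_index k d n l (x * d ^ n + c) = x0 * d + a' \<longleftrightarrow> digit k l x = x0 \<and> digit d l c = a'"
    if "x < k ^ n" "c < d ^ n" for x c
    unfolding pair_index_pair[OF that(2)] using div_pair[OF assms(2), of x0] mod_pair[OF assms(2), of x0]
      div_pair[OF digit_less[OF that(2) assms(3)], of "digit k l x"]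
      mod_pair[OF digit_less[OF that(2) assms(3)], of "digit k l x"]
    by metis
  then show ?thesis
    unfolding sum_pair by (intro sum.cong refl) auto
qed

lemma pair_marginal_iid:
  assumes \<omega>: "diag_state (k * d) \<omega> w" and w1: "(\<Sum>x<k. \<Sum>c<d. w (x * d + c)) = 1" and l: "l < n"
  shows "pair_marginal k d n l (iid_state k d n \<omega>) = \<omega>"
proof (rule eq_matI)
  note I = diag_stateD[OF iid_state_diag[OF \<omega>]]
  fix a b assume "a < dim_row \<omega>" "b < dim_col \<omega>"
  then have ab: "a < k * d" "b < k * d" using diag_stateD(1)[OF \<omega>] by auto
  obtain x0 a' where a: "x0 < k" "a' < d" "a = x0 * d + a'"
    using ab(1) by (rule pair_cases)
  \<comment> \<open>The indicator of the prescribed pair sits in the \<open>l\<close>-th factor, so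
    the sum over words factorises and every other factor sums to 1.\<close>
  let ?F = "\<lambda>m x c. if m = l then if x = x0 then if c = a' then w a else 0 else 0 else w (x * d + c)"
  have "(\<Sum>i<k ^ n * d ^ n. if pair_index k d n l i = a then iid_state k d n \<omega> $$ (i, i) else 0) =
     of_real (\<Sum>i<k ^ n * d ^ n. if pair_index k d n l i = a then \<Prod>m<n. w (pair_index k d n m i) else 0)"
    by (auto simp: I(2) intro!: sum.cong)
  also have "(\<Sum>i<k ^ n * d ^ n. if pair_index k d n l i = a then \<Prod>m<n. w (pair_index k d n m i) else 0) =
     (\<Sum>x<k ^ n. \<Sum>c<d ^ n. if digit k l x = x0 \<and> digit d l c = a' then
        \<Prod>m<n. w (digit k m x * d + digit d m c) else 0)"
    unfolding a(3) sum_pair_index[OF a(1,2) l] by (intro sum.cong refl) (simp add: pair_index_pair)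
  also have "\<dots> = (\<Sum>x<k ^ n. \<Sum>c<d ^ n. \<Prod>m<n. ?F m (digit k m x) (digit d m c))"
  proof (intro sum.cong refl)
    fix x c
    show "(if digit k l x = x0 \<and> digit d l c = a' then \<Prod>m<n. w (digit k m x * d + digit d m c) else 0) =
        (\<Prod>m<n. ?F m (digit k m x) (digit d m c))"
    proof (cases "digit k l x = x0 \<and> digit d l c = a'")
      case True
      then show ?thesis by (auto simp: a(3) intro!: prod.cong)
    next
      case False
      then have "?F l (digit k l x) (digit d l c) = 0" by auto
      then show ?thesis
        using False l prod_zero[of "{..<n}" "\<lambda>m. ?F m (digit k m x) (digit d m c)"] by auto
    qed
  qed
  also have "\<dots> = (\<Sum>x<k ^ n. \<Prod>m<n. \<Sum>c<d. ?F m (digit k m x) c)"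
    by (intro sum.cong refl sum_prod_digit)
  also have "\<dots> = (\<Prod>m<n. \<Sum>x<k. \<Sum>c<d. ?F m x c)"
    by (rule sum_prod_digit)
  also have "\<dots> = (\<Prod>m<n. if m = l then w a else 1)"
  proof (rule prod.cong[OF refl])
    fix m
    show "(\<Sum>x<k. \<Sum>c<d. ?F m x c) = (if m = l then w a else 1)"
      using a by (cases "m = l") (simp_all add: w1 sum_if_zero)
  qed
  also have "\<dots> = w a"
    using l by simp
  finally show "pair_marginal k d n l (iid_state k d n \<omega>) $$ (a, b) = \<omega> $$ (a, b)"
    using ab I(2) by (subst pair_marginal_index[OF ab l]) (auto simp: diag_stateD(2)[OF \<omega>])
qed (use diag_stateD(1)[OF \<omega>] in \<open>auto simp: pair_marginal_def\<close>)

text \<open>Both criteria end in the same single-letter estimate. In the global case the diagonals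
  are compared on whole words, and taking a marginal cannot increase their l1 distance. The factor 2
  undoes the 1/2 in the trace distance.\<close>

lemma criterion_marginal_error:
  assumes \<omega>: "diag_state (k * d) \<omega> w" and w1: "(\<Sum>x<k. \<Sum>c<d. w (x * d + c)) = 1" and l: "l < n"
    and \<tau>: "\<tau> \<in> carrier_mat (k ^ n * d ^ n) (k ^ n * d ^ n)"
    and crit: "meets_criterion crit k d \<omega> n \<epsilon> \<tau>"
  shows "(\<Sum>a<k * d. cmod (pair_marginal k d n l \<tau> $$ (a, a) - of_real (w a))) \<le> 2 * \<epsilon>"
proof (cases crit)
  case Local
  have "(\<Sum>a<k * d. cmod (pair_marginal k d n l \<tau> $$ (a, a) - of_real (w a))) =
      (\<Sum>a<k * d. cmod (pair_marginal k d n l \<tau> $$ (a, a) - \<omega> $$ (a, a)))"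
    by (intro sum.cong refl) (simp add: diag_stateD(2)[OF \<omega>])
  also have "\<dots> \<le> 2 * trace_distance (pair_marginal k d n l \<tau>) \<omega>"
    by (rule trace_distance_diag[OF _ diag_stateD(1)[OF \<omega>]]) (simp add: pair_marginal_def)
  finally show ?thesis
    using crit Local l by force
next
  case Global
  let ?I = "iid_state k d n \<omega>"
  let ?N = "k ^ n * d ^ n"
  have "pair_marginal k d n l \<tau> $$ (a, a) - of_real (w a) =
      (\<Sum>i<?N. if pair_index k d n l i = a then \<tau> $$ (i, i) - ?I $$ (i, i) else 0)" if a: "a < k * d" for a
  proof -
    have "of_real (w a) = pair_marginal k d n l ?I $$ (a, a)"
      using pair_marginal_iid[OF \<omega> w1 l] a diag_stateD(2)[OF \<omega>] by simp
    also have "\<dots> = (\<Sum>i<?N. if pair_index k d n l i = a then ?I $$ (i, i) else 0)"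
      by (subst pair_marginal_index[OF a a l]) auto
    finally have I: "of_real (w a) = \<dots>" .
    have "pair_marginal k d n l \<tau> $$ (a, a) = (\<Sum>i<?N. if pair_index k d n l i = a then \<tau> $$ (i, i) else 0)"
      by (subst pair_marginal_index[OF a a l]) auto
    then show ?thesis
      unfolding I by (simp only: sum_subtractf[symmetric]) (intro sum.cong refl, simp)
  qed
  then have "(\<Sum>a<k * d. cmod (pair_marginal k d n l \<tau> $$ (a, a) - of_real (w a))) \<le>
      (\<Sum>a<k * d. \<Sum>i<?N. if pair_index k d n l i = a then cmod (\<tau> $$ (i, i) - ?I $$ (i, i)) else 0)"
    by (auto intro!: sum_mono order.trans[OF norm_sum])
  also have "\<dots> = (\<Sum>i<?N. \<Sum>a<k * d. if pair_index k d n l i = a then cmod (\<tau> $$ (i, i) - ?I $$ (i, i)) else 0)"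
    by (rule sum.swap)
  also have "\<dots> = (\<Sum>i<?N. cmod (\<tau> $$ (i, i) - ?I $$ (i, i)))"
    using l by (intro sum.cong refl) (simp add: pair_index_less)
  also have "\<dots> \<le> 2 * trace_distance \<tau> ?I"
    by (rule trace_distance_diag[OF \<tau>]) (simp add: iid_state_def)
  finally show ?thesis
    using crit Global by simp
qed

lemma protocol_letter_channel:
  assumes P: "is_protocol k d \<omega> n R P"
    and \<omega>: "diag_state (k * d) \<omega> w" and w1: "(\<Sum>x<k. \<Sum>c<d. w (x * d + c)) = 1"
    and w0: "\<And>i. 0 \<le> w i" and d: "0 < d"
    and crit: "meets_criterion crit k d \<omega> n \<epsilon>
          (ptrace_mid (k ^ n) (d ^ n) (d ^ n) (final_state k d \<omega> n R P))"
  obtains W Q where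
    "iid_channel k d n (\<lambda>x c. w (x * d + c)) W"
    "\<And>c c'. c < d ^ n \<Longrightarrow> c' < d ^ n \<Longrightarrow> W c c' \<le> Q c'"
    "(\<Sum>c'<d ^ n. Q c') = real (message_size n R)"
    "\<And>l. l < n \<Longrightarrow> (\<Sum>x<k. \<Sum>a'<d. \<bar>(\<Sum>a<d. w (x * d + a) *
        iid_channel.letter_channel k d n (\<lambda>x c. w (x * d + c)) W l a a') - w (x * d + a')\<bar>) \<le> 2 * \<epsilon>"
proof -
  let ?p = "\<lambda>i. \<Prod>l<n. w (pair_index k d n l i)"
  let ?\<tau> = "ptrace_mid (k ^ n) (d ^ n) (d ^ n) (final_state k d \<omega> n R P)"
  obtain W Q where W: "\<And>c c'. c' < d ^ n \<Longrightarrow> 0 \<le> W c c'"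
    "\<And>c. c < d ^ n \<Longrightarrow> (\<Sum>c'<d ^ n. W c c') = 1"
    and Q: "\<And>c c'. c < d ^ n \<Longrightarrow> c' < d ^ n \<Longrightarrow> W c c' \<le> Q c'"
    "(\<Sum>c'<d ^ n. Q c') = real (message_size n R)"
    and \<tau>: "\<And>x c'. x < k ^ n \<Longrightarrow> c' < d ^ n \<Longrightarrow> ?\<tau> $$ (x * d ^ n + c', x * d ^ n + c') =
       of_real (\<Sum>c<d ^ n. ?p (x * d ^ n + c) * W c c')"
    using protocol_channel[OF P diag_stateD(2)[OF iid_state_diag[OF \<omega>]]] by blast
  have "(\<Sum>c<d. \<Sum>x<k. w (x * d + c)) = 1"
    using w1 by (subst sum.swap)
  then interpret iid_channel k d n "\<lambda>x c. w (x * d + c)" W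
    using W w0 d by unfold_locales auto
  have err: "(\<Sum>x<k. \<Sum>a'<d. \<bar>(\<Sum>a<d. w (x * d + a) * letter_channel l a a') - w (x * d + a')\<bar>) \<le> 2 * \<epsilon>"
    if l: "l < n" for l
  proof -
    have c: "?\<tau> \<in> carrier_mat (k ^ n * d ^ n) (k ^ n * d ^ n)"
      by (simp add: ptrace_mid_def)
    have "pair_marginal k d n l ?\<tau> $$ (x0 * d + a', x0 * d + a') =
        of_real (\<Sum>a<d. w (x0 * d + a) * letter_channel l a a')" if x: "x0 < k" "a' < d" for x0 a'
    proof -
      have lt: "x0 * d + a' < k * d" using x by (rule pair_less)
      have "pair_marginal k d n l ?\<tau> $$ (x0 * d + a', x0 * d + a') =
        (\<Sum>x<k ^ n. \<Sum>c'<d ^ n. if digit k l x = x0 \<and> digit d l c' = a' then ?\<tau> $$ (x * d ^ n + c', x * d ^ n + c') else 0)"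
        by (subst pair_marginal_index[OF lt lt l]) (simp_all add: sum_pair_index[OF x l])
      also have "\<dots> = of_real (\<Sum>x<k ^ n. \<Sum>c'<d ^ n. if digit k l x = x0 \<and> digit d l c' = a' then
          \<Sum>c<d ^ n. (\<Prod>m<n. w (digit k m x * d + digit d m c)) * W c c' else 0)"
        unfolding of_real_sum by (intro sum.cong refl) (auto simp: \<tau> pair_index_pair)
      also have "\<dots> = of_real (\<Sum>a<d. w (x0 * d + a) * letter_channel l a a')"
        by (simp only: letter_channel_marginal[OF l x(1)])
      finally show ?thesis .
    qed
    then have "(\<Sum>x<k. \<Sum>a'<d. \<bar>(\<Sum>a<d. w (x * d + a) * letter_channel l a a') - w (x * d + a')\<bar>) =
       (\<Sum>a<k * d. cmod (pair_marginal k d n l ?\<tau> $$ (a, a) - of_real (w a)))"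
      unfolding sum_pair by (intro sum.cong refl) (simp del: of_real_sum of_real_mult flip: of_real_diff)
    also have "\<dots> \<le> 2 * \<epsilon>"
      by (rule criterion_marginal_error[OF \<omega> w1 l c crit])
    finally show ?thesis .
  qed
  show ?thesis
    by (rule that[OF iid_channel_axioms Q err])
qed

section \<open>Mutual information of diagonal states\<close>

lemma von_neumann_entropy_diag:
  assumes "diag_state m A p"
  shows "von_neumann_entropy A = - (\<Sum>i<m. p i * log 2 (p i))"
proof -
  have "upper_triangular A"
    using diag_stateD[OF assms] by auto
  then show ?thesis
    using diag_stateD[OF assms] by (simp add: von_neumann_entropy_def spectral_trace_upper_triangular)
qed

text \<open>The mutual information as the relative entropy between the joint law and the product of
  its marginals, from which both bounds below are read off.\<close>

lemma mutual_information_diag: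
  assumes A: "diag_state (k * d) A w"
  shows "mutual_information k d A =
    (\<Sum>x<k. \<Sum>c<d. w (x * d + c) * (log 2 (w (x * d + c)) - log 2 (\<Sum>x<k. w (x * d + c)) - log 2 (\<Sum>c<d. w (x * d + c))))"
proof -
  have "diag_state k (ptrace_mid k d 1 A) (\<lambda>x. \<Sum>c<d. w (x * d + c))"
    unfolding diag_state_def
  proof (intro conjI allI impI)
    fix i j assume ij: "i < k" "j < k"
    have "ptrace_mid k d 1 A $$ (i, j) = (\<Sum>c<d. A $$ (i * d + c, j * d + c))"
      using ij by (simp add: ptrace_mid_def)
    also have "\<dots> = (\<Sum>c<d. if i = j then of_real (w (i * d + c)) else 0)"
    proof (intro sum.cong refl)
      fix c assume "c \<in> {..<d}"
      then have "i * d + c < k * d" "j * d + c < k * d" "0 < d"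
        using ij by (auto intro: pair_less)
      then show "A $$ (i * d + c, j * d + c) = (if i = j then of_real (w (i * d + c)) else 0)"
        by (simp add: diag_stateD(2)[OF A])
    qed
    finally show "ptrace_mid k d 1 A $$ (i, j) = (if i = j then of_real (\<Sum>c<d. w (i * d + c)) else 0)"
      by simp
  qed (simp add: ptrace_mid_def)
  moreover have "diag_state d (ptrace_mid 1 k d A) (\<lambda>c. \<Sum>x<k. w (x * d + c))"
    unfolding diag_state_def
  proof (intro conjI allI impI)
    fix i j assume ij: "i < d" "j < d"
    have "ptrace_mid 1 k d A $$ (i, j) = (\<Sum>x<k. A $$ (x * d + i, x * d + j))"
      using ij by (simp add: ptrace_mid_def)
    also have "\<dots> = (\<Sum>x<k. if i = j then of_real (w (x * d + i)) else 0)"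
      using ij by (intro sum.cong refl) (simp add: pair_less diag_stateD(2)[OF A])
    finally show "ptrace_mid 1 k d A $$ (i, j) = (if i = j then of_real (\<Sum>x<k. w (x * d + i)) else 0)"
      by simp
  qed (simp add: ptrace_mid_def)
  ultimately have "mutual_information k d A =
     (\<Sum>x<k. \<Sum>c<d. w (x * d + c) * log 2 (w (x * d + c)))
     - (\<Sum>x<k. \<Sum>c<d. w (x * d + c) * log 2 (\<Sum>c<d. w (x * d + c)))
     - (\<Sum>c<d. \<Sum>x<k. w (x * d + c) * log 2 (\<Sum>x<k. w (x * d + c)))"
    by (simp only: mutual_information_def von_neumann_entropy_diag[OF A] von_neumann_entropy_diag
        sum_pair sum_distrib_right)
  also have "(\<Sum>c<d. \<Sum>x<k. w (x * d + c) * log 2 (\<Sum>x<k. w (x * d + c))) =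
      (\<Sum>x<k. \<Sum>c<d. w (x * d + c) * log 2 (\<Sum>x<k. w (x * d + c)))"
    by (rule sum.swap)
  finally show ?thesis
    by (simp add: right_diff_distrib sum_subtractf)
qed

text \<open>Gibbs' inequality, from ln z \<le> z - 1 at the ratio of the product law to the joint
  law. It serves the upper bound on the information defect.\<close>

lemma mutual_information_nonneg:
  assumes A: "diag_state (k * d) A w"
    and pos: "\<And>x c. x < k \<Longrightarrow> c < d \<Longrightarrow> 0 < w (x * d + c)"
    and w1: "(\<Sum>x<k. \<Sum>c<d. w (x * d + c)) = 1"
  shows "0 \<le> mutual_information k d A"
proof -
  define p where "p x = (\<Sum>c<d. w (x * d + c))" for x
  define q where "q c = (\<Sum>x<k. w (x * d + c))" for c
  have pq: "w (x * d + c) \<le> p x" "w (x * d + c) \<le> q c" if "x < k" "c < d" for x c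
    unfolding p_def q_def using that pos
      member_le_sum[of c "{..<d}" "\<lambda>c. w (x * d + c)"] member_le_sum[of x "{..<k}" "\<lambda>x. w (x * d + c)"]
    by (auto simp: less_imp_le)
  have "(\<Sum>x<k. \<Sum>c<d. w (x * d + c) - p x * q c) = 0"
  proof -
    have "(\<Sum>c<d. q c) = 1"
      unfolding q_def using w1 by (subst sum.swap)
    moreover have "(\<Sum>x<k. p x) = 1"
      using w1 by (simp add: p_def)
    ultimately show ?thesis
      using w1 by (simp add: sum_subtractf flip: sum_product)
  qed
  moreover have "w (x * d + c) - p x * q c \<le> ln 2 * (w (x * d + c) * (log 2 (w (x * d + c)) - log 2 (q c) - log 2 (p x)))"
    if "x < k" "c < d" for x c
  proof -
    let ?w = "w (x * d + c)"
    have gt: "0 < ?w" "0 < p x" "0 < q c" using pos[OF that] pq[OF that] by auto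
    have "ln (p x * q c / ?w) \<le> p x * q c / ?w - 1"
      using gt by (intro ln_le_minus_one) simp
    then have "?w * ln (p x * q c / ?w) \<le> ?w * (p x * q c / ?w - 1)"
      using gt by (intro mult_left_mono) auto
    also have "\<dots> = p x * q c - ?w"
      using gt by (simp add: right_diff_distrib)
    also have "ln (p x * q c / ?w) = ln (p x) + ln (q c) - ln ?w"
      using gt by (simp add: ln_div ln_mult)
    finally have "?w - p x * q c \<le> ?w * (ln ?w - ln (q c) - ln (p x))"
      by (simp add: algebra_simps)
    then show ?thesis
      by (simp add: log_def right_diff_distrib)
  qed
  ultimately have "0 \<le> (\<Sum>x<k. \<Sum>c<d. ln 2 * (w (x * d + c) * (log 2 (w (x * d + c)) - log 2 (q c) - log 2 (p x))))"
    by (metis (no_types, lifting) lessThan_iff sum_mono)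
  also have "\<dots> = ln 2 * mutual_information k d A"
    by (simp only: mutual_information_diag[OF A] p_def q_def sum_distrib_left)
  finally show ?thesis
    by (simp add: zero_le_mult_iff)
qed

text \<open>I(X:C) \<le> S(X), since a joint probability never exceeds the marginal of
  \<open>c\<close>, so the conditional entropy of X given C is nonnegative.\<close>

lemma mutual_information_le_entropy:
  assumes A: "diag_state (k * d) A w"
    and pos: "\<And>x c. x < k \<Longrightarrow> c < d \<Longrightarrow> 0 < w (x * d + c)"
  shows "mutual_information k d A \<le> - (\<Sum>x<k. (\<Sum>c<d. w (x * d + c)) * log 2 (\<Sum>c<d. w (x * d + c)))"
proof -
  have "mutual_information k d A \<le> (\<Sum>x<k. \<Sum>c<d. w (x * d + c) * (- log 2 (\<Sum>c<d. w (x * d + c))))"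
    unfolding mutual_information_diag[OF A]
  proof (intro sum_mono mult_left_mono)
    fix x c assume "x \<in> {..<k}" "c \<in> {..<d}"
    then have xc: "x < k" "c < d" by auto
    have "w (x * d + c) \<le> (\<Sum>x<k. w (x * d + c))"
      using xc pos by (intro member_le_sum[of x "{..<k}" "\<lambda>x. w (x * d + c)"]) (auto intro: less_imp_le)
    then show "log 2 (w (x * d + c)) - log 2 (\<Sum>x<k. w (x * d + c)) - log 2 (\<Sum>c<d. w (x * d + c))
        \<le> - log 2 (\<Sum>c<d. w (x * d + c))"
      using pos[OF xc] by simp
    show "0 \<le> w (x * d + c)" using pos[OF xc] by simp
  qed
  also have "\<dots> = - (\<Sum>x<k. (\<Sum>c<d. w (x * d + c)) * log 2 (\<Sum>c<d. w (x * d + c)))"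
    by (simp only: sum_distrib_right sum_negf mult_minus_right)
  finally show ?thesis .
qed

section \<open>The copying protocol\<close>

text \<open>Measures the word and writes the outcome into both the retained register and
  \<open>T\<close>. Diagonal inputs survive this unharmed.\<close>

definition copy_encoder :: "nat \<Rightarrow> complex mat \<Rightarrow> complex mat" where
  "copy_encoder N M = mat (N * N) (N * N)
     (\<lambda>(i, j). if i = j \<and> i div N = i mod N then M $$ (i div N, i div N) else 0)"

text \<open>With an ancilla attached, the output consists of the diagonal blocks of \<open>M\<close>
  placed at the positions with equal entries in both registers, and diagonal blocks of a positive
  matrix are positive.\<close>

lemma cptp_copy_encoder: "cptp N (N * N) (copy_encoder N)"
proof -
  have psd: "pos_semidef (N * N * r) (lift_map 1 r N (N * N) (copy_encoder N) M)" if M: "pos_semidef (N * r) M" for r M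
  proof -
    let ?L = "lift_map 1 r N (N * N) (copy_encoder N) M"
    have idx: "?L $$ ((z * N + c) * r + e, (z' * N + c') * r + e') =
        (if z = z' then if c = c' then if z = c then M $$ (z * r + e, z * r + e') else 0 else 0 else 0)"
      if "z < N" "c < N" "z' < N" "c' < N" "e < r" "e' < r" for z c z' c' e e'
    proof -
      have y: "z * N + c < N * N" "z' * N + c' < N * N" using that by (auto intro: pair_less)
      have "(z * N + c) * r + e < N * N * r" "(z' * N + c') * r + e' < N * N * r"
        using y that by (auto intro: pair_less)
      moreover have "z * N + c = z' * N + c' \<longleftrightarrow> z = z' \<and> c = c'"
        using that by (metis div_pair mod_pair)
      ultimately show ?thesis
        using y that by (auto simp: lift_map_def copy_encoder_def)
    qed
    have "quadratic_form (N * N * r) ?L f = (\<Sum>z<N. \<Sum>e<r. \<Sum>e'<r.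
        cnj (f ((z * N + z) * r + e)) * M $$ (z * r + e, z * r + e') * f ((z * N + z) * r + e'))" for f
    proof -
      have "quadratic_form (N * N * r) ?L f = (\<Sum>z<N. \<Sum>c<N. \<Sum>e<r. \<Sum>z'<N. \<Sum>c'<N. \<Sum>e'<r.
          if z' = z then if c' = c then if c = z then
        cnj (f ((z * N + z) * r + e)) * M $$ (z * r + e, z * r + e') * f ((z * N + z) * r + e') else 0 else 0 else 0)"
        unfolding quadratic_form_def sum_pair by (intro sum.cong refl) (auto simp: idx simp del: One_nat_def)
      then show ?thesis
        by (simp add: sum_if_zero)
    qed
    then show ?thesis
      using pos_semidef_block[OF M]
      by (auto simp: pos_semidef_iff intro!: sum_nonneg[where A = "{..<N}"]) (simp add: lift_map_def)
  qed
  have tr: "mat_trace (copy_encoder N A) = mat_trace A" if "A \<in> carrier_mat N N" for A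
  proof -
    have "mat_trace (copy_encoder N A) = (\<Sum>z<N. \<Sum>c<N. copy_encoder N A $$ (z * N + c, z * N + c))"
      by (rule mat_trace_pair) (simp add: copy_encoder_def)
    also have "\<dots> = (\<Sum>z<N. \<Sum>c<N. if c = z then A $$ (z, z) else 0)"
      by (intro sum.cong refl) (auto simp: copy_encoder_def pair_less)
    finally show ?thesis
      using that by (simp add: mat_trace_def)
  qed
  have div: "i div N < N" if "i < N * N" for i
    using that by (simp add: less_mult_imp_div_less)
  have carrier: "copy_encoder N A \<in> carrier_mat (N * N) (N * N)" for A
    by (simp add: copy_encoder_def)
  have add: "copy_encoder N (A + B) = copy_encoder N A + copy_encoder N B"
    if "A \<in> carrier_mat N N" "B \<in> carrier_mat N N" for A B
    using that div by (intro eq_matI) (auto simp: copy_encoder_def)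
  have smult: "copy_encoder N (c \<cdot>\<^sub>m A) = c \<cdot>\<^sub>m copy_encoder N A" if "A \<in> carrier_mat N N" for c A
    using that div by (intro eq_matI) (auto simp: copy_encoder_def)
  show ?thesis
    unfolding cptp_def using carrier add smult psd tr by blast
qed

lemma lift_map_id:
  assumes M: "M \<in> carrier_mat (l * m * r) (l * m * r)"
  shows "lift_map l r m m (\<lambda>A. A) M = M"
proof (rule eq_matI)
  fix i j assume "i < dim_row M" "j < dim_col M"
  then have ij: "i < l * m * r" "j < l * m * r" using M by auto
  have idx: "i div (m * r) * (m * r) + i div r mod m * r + i mod r = i" "i div r mod m < m" if i: "i < l * m * r" for i
  proof -
    have r: "0 < r" "0 < m" using i by (auto intro: gr0I)
    then show "i div r mod m < m" by simp
    obtain y e where y: "y < l * m" "e < r" "i = y * r + e"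
      using i by (rule pair_cases)
    then have "i div (m * r) = y div m"
      by (simp add: mult.commute[of m] div_mult2_eq)
    then show "i div (m * r) * (m * r) + i div r mod m * r + i mod r = i"
      using y by (simp flip: distrib_right mult.assoc add: div_mult_mod_eq)
  qed
  show "lift_map l r m m (\<lambda>A. A) M $$ (i, j) = M $$ (i, j)"
    using ij idx[OF ij(1)] idx[OF ij(2)] by (simp add: lift_map_def)
qed (use M in \<open>auto simp: lift_map_def\<close>)

lemma cptp_id: "cptp m m (\<lambda>A. A)"
proof -
  have "lift_map 1 r m m (\<lambda>A. A) M = M" if "pos_semidef (m * r) M" for r M
    using that lift_map_id[of M 1 m r] by (simp add: pos_semidef_def)
  then show ?thesis
    by (auto simp: cptp_def)
qed

text \<open>At this rate the floor is exact: \<open>T\<close> has one value per word, so the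
  identity can serve as the decoder.\<close>

lemma message_size_log:
  assumes "0 < d"
  shows "message_size n (log 2 (real d)) = d ^ n"
proof -
  have "2 powr (real n * log 2 (real d)) = (2 powr log 2 (real d)) powr real n"
    by (simp add: powr_powr mult.commute)
  also have "\<dots> = real (d ^ n)"
    using assms by (simp add: powr_realpow)
  finally show ?thesis
    by (simp only: message_size_def floor_of_nat nat_int)
qed

definition copy_protocol :: "nat \<Rightarrow> ea_protocol" where
  "copy_protocol N = \<lparr>ent_dim_A = 1, ent_dim_B = 1, ent_state = vec 1 (\<lambda>_. 1),
     encoder = copy_encoder N, decoder = (\<lambda>A. A)\<rparr>"

lemma copy_protocol_encoded_index:
  assumes I: "diag_state (K * N) I p"
    and "i < K * N" "c < N" "j < K * N" "c' < N"
  shows "lift_map K 1 N (N * N) (copy_encoder N) I $$ (i * N + c, j * N + c') =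
    (if i = j \<and> c = c' \<and> i mod N = c then of_real (p i) else 0)"
proof -
  obtain x z where i: "x < K" "z < N" "i = x * N + z"
    using assms(2) by (rule pair_cases)
  obtain y u where j: "y < K" "u < N" "j = y * N + u"
    using assms(4) by (rule pair_cases)
  have lt: "z * N + c < N * N" "u * N + c' < N * N" "x * N + c < K * N" "y * N + c < K * N"
    using assms i j by (auto intro: pair_less)
  have eq: "i * N + c = x * (N * N) + (z * N + c)" "j * N + c' = y * (N * N) + (u * N + c')"
    by (simp_all add: i j algebra_simps)
  have "x * (N * N) + (z * N + c) < K * (N * N)" "y * (N * N) + (u * N + c') < K * (N * N)"
    using lt i j by (auto intro: pair_less)
  then have "lift_map K 1 N (N * N) (copy_encoder N) I $$ (i * N + c, j * N + c') =
      copy_encoder N (mat N N (\<lambda>(a, b). I $$ (x * N + a, y * N + b))) $$ (z * N + c, u * N + c')"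
    using lt unfolding eq by (simp add: lift_map_def)
  also have "\<dots> = (if z = u \<and> c = c' \<and> z = c then I $$ (x * N + c, y * N + c) else 0)"
  proof -
    have "z * N + c = u * N + c' \<longleftrightarrow> z = u \<and> c = c'"
      using assms by (metis div_pair mod_pair)
    then show ?thesis
      using lt assms i by (auto simp: copy_encoder_def)
  qed
  also have "\<dots> = (if i = j \<and> c = c' \<and> i mod N = c then of_real (p i) else 0)"
  proof -
    have "x * N + c = y * N + c \<longleftrightarrow> x = y" "i = j \<longleftrightarrow> x = y \<and> z = u"
      using assms i j by (metis div_pair mod_pair)+
    then show ?thesis
      using lt i by (auto simp: diag_stateD(2)[OF I])
  qed
  finally show ?thesis .
qed

text \<open>The encoded state holds the word twice. Tracing out \<open>T\<close> shows that Alice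
  retains her input, and tracing out her copy shows that Bob's output is exact.\<close>

lemma copy_protocol_correct:
  fixes n :: nat
  assumes d: "0 < d" and \<omega>: "diag_state (k * d) \<omega> w"
  defines "P \<equiv> copy_protocol (d ^ n)"
  shows "is_protocol k d \<omega> n (log 2 (real d)) P"
    and "ptrace_mid (k ^ n) (d ^ n) (d ^ n) (final_state k d \<omega> n (log 2 (real d)) P) = iid_state k d n \<omega>"
proof -
  define N where "N = d ^ n"
  define K where "K = k ^ n"
  define I where "I = iid_state k d n \<omega>"
  define p where "p i = (\<Prod>l<n. w (pair_index k d n l i))" for i
  have I: "diag_state (K * N) I p"
    using iid_state_diag[OF \<omega>, of n] by (simp add: K_def N_def I_def p_def[abs_def])
  have t: "message_size n (log 2 (real d)) = N"
    by (simp add: message_size_log[OF d] N_def)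
  define E where "E = lift_map K 1 N (N * N) (copy_encoder N) I"
  note E_index = copy_protocol_encoded_index[OF I, folded E_def]
  have "tensor_mat I (ket_bra (vec 1 (\<lambda>_. 1))) = I"
    by (rule eq_matI) (auto simp: tensor_mat_def ket_bra_def)
  then have enc: "encoded_state k d \<omega> n (log 2 (real d)) P = E"
    by (simp add: E_def encoded_state_def t P_def copy_protocol_def flip: K_def N_def I_def)
  have E_carrier: "E \<in> carrier_mat (K * N * N) (K * N * N)"
    by (simp add: E_def lift_map_def mult.assoc)
  have fin: "final_state k d \<omega> n (log 2 (real d)) P = E"
    using lift_map_id[of E "K * N" N 1] E_carrier
    unfolding final_state_def enc t by (simp add: P_def copy_protocol_def flip: K_def N_def)
  have retained: "ptrace_mid (K * N) N 1 E = I"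
  proof (rule eq_matI)
    fix i j assume "i < dim_row I" "j < dim_col I"
    then have ij: "i < K * N" "j < K * N" using diag_stateD(1)[OF I] by auto
    have "0 < N" using ij by (auto intro: gr0I)
    have "ptrace_mid (K * N) N 1 E $$ (i, j) = (\<Sum>a<N. E $$ (i * N + a, j * N + a))"
      using ij by (simp add: ptrace_mid_def)
    also have "\<dots> = (\<Sum>a<N. if i mod N = a then if i = j then of_real (p i) else 0 else 0)"
      using ij by (intro sum.cong refl) (auto simp: E_index)
    also have "\<dots> = I $$ (i, j)"
      using ij \<open>0 < N\<close> by (simp add: diag_stateD(2)[OF I])
    finally show "ptrace_mid (K * N) N 1 E $$ (i, j) = I $$ (i, j)" .
  qed (use diag_stateD(1)[OF I] in \<open>auto simp: ptrace_mid_def\<close>)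
  have "ptrace_mid K N N E = I"
  proof (rule eq_matI)
    fix i j assume "i < dim_row I" "j < dim_col I"
    then have ij: "i < K * N" "j < K * N" using diag_stateD(1)[OF I] by auto
    obtain x c where i: "x < K" "c < N" "i = x * N + c"
      using ij(1) by (rule pair_cases)
    obtain y e where j: "y < K" "e < N" "j = y * N + e"
      using ij(2) by (rule pair_cases)
    have "ptrace_mid K N N E $$ (i, j) = (\<Sum>z<N. E $$ ((x * N + z) * N + c, (y * N + z) * N + e))"
      using i j ij by (simp add: ptrace_mid_def algebra_simps)
    also have "\<dots> = (\<Sum>z<N. if z = c then if x = y \<and> c = e then of_real (p i) else 0 else 0)"
    proof (intro sum.cong refl)
      fix z assume "z \<in> {..<N}"
      then have z: "z < N" by simp
      have "x * N + z = y * N + z \<longleftrightarrow> x = y"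
        using z by (metis div_pair)
      then show "E $$ ((x * N + z) * N + c, (y * N + z) * N + e) =
          (if z = c then if x = y \<and> c = e then of_real (p i) else 0 else 0)"
        using z i j pair_less[OF i(1) z] pair_less[OF j(1) z]
        by (auto simp: E_index)
    qed
    also have "\<dots> = I $$ (i, j)"
    proof -
      have "i = j \<longleftrightarrow> x = y \<and> c = e"
        using i j by (metis div_pair mod_pair)
      then show ?thesis
        using ij i by (simp add: diag_stateD(2)[OF I])
    qed
    finally show "ptrace_mid K N N E $$ (i, j) = I $$ (i, j)" .
  qed (use diag_stateD(1)[OF I] in \<open>auto simp: ptrace_mid_def\<close>)
  then show "ptrace_mid (k ^ n) (d ^ n) (d ^ n) (final_state k d \<omega> n (log 2 (real d)) P) = iid_state k d n \<omega>"
    by (simp add: fin flip: K_def N_def I_def)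
  have unit: "vec 1 (\<lambda>_. 1) \<bullet>c vec 1 (\<lambda>_. 1) = (1 :: complex)"
    by (simp add: scalar_prod_def)
  have "copy_encoder N M $$ (i, j) = 0" if "i < N * N" "j < N * N" "i mod N \<noteq> j mod N" for M i j
    using that by (auto simp: copy_encoder_def)
  then show "is_protocol k d \<omega> n (log 2 (real d)) P"
    using cptp_copy_encoder[of N] cptp_id[of N] retained unit
    by (simp add: is_protocol_def Let_def enc t) (simp add: P_def copy_protocol_def flip: K_def N_def I_def)
qed

text \<open>Shows that the infimum in the information defect is over a nonempty set and is at most
  log d.\<close>

lemma achievable_log_dim:
  assumes d: "0 < d" and \<omega>: "diag_state (k * d) \<omega> w" and w1: "(\<Sum>x<k. \<Sum>c<d. w (x * d + c)) = 1"
    and \<epsilon>: "0 \<le> \<epsilon>"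
  shows "achievable crit k d \<omega> \<epsilon> (log 2 (real d))"
proof -
  have "meets_criterion crit k d \<omega> n \<epsilon> (iid_state k d n \<omega>)" for n
  proof (cases crit)
    case Global
    then show ?thesis
      using \<epsilon> by (simp add: trace_distance_self[of _ "k ^ n * d ^ n"] iid_state_def)
  next
    case Local
    then show ?thesis
      using \<epsilon> trace_distance_self[OF diag_stateD(1)[OF \<omega>]] by (simp add: pair_marginal_iid[OF \<omega> w1])
  qed
  then have "is_protocol k d \<omega> n (log 2 (real d)) (copy_protocol (d ^ n)) \<and>
      meets_criterion crit k d \<omega> n \<epsilon> (ptrace_mid (k ^ n) (d ^ n) (d ^ n)
        (final_state k d \<omega> n (log 2 (real d)) (copy_protocol (d ^ n))))" for n
    using copy_protocol_correct[OF d \<omega>] by simp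
  then show ?thesis
    unfolding achievable_def by (intro always_eventually allI exI)
qed

section \<open>The ensemble\<close>

lemma sum_two: "(\<Sum>x<2. f x) = f 0 + f (1 :: nat)"
  by (simp add: numeral_2_eq_2)

text \<open>Indexed by the product basis \<open>x * d + c\<close> of \<open>XC\<close>.\<close>

definition ensemble_weight :: "nat \<Rightarrow> nat \<Rightarrow> real" where
  "ensemble_weight d i = (if i < d then 1 / (2 * d) else real (d - i mod d) / (d * (real d + 1)))"

lemma ensemble_XC_diag:
  assumes "0 < d"
  shows "diag_state (2 * d) (ensemble_XC d) (ensemble_weight d)"
proof -
  have "ensemble_XC d $$ (i, j) = (if i = j then of_real (ensemble_weight d i) else 0)"
    if ij: "i < 2 * d" "j < 2 * d" for i j
  proof -
    obtain x c where i: "x < 2" "c < d" "i = x * d + c"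
      using ij(1) by (rule pair_cases)
    obtain y e where j: "y < 2" "e < d" "j = y * d + e"
      using ij(2) by (rule pair_cases)
    have "x = 0 \<or> x = 1" "y = 0 \<or> y = 1" using i j by auto
    then show ?thesis
      using ij i j by (auto simp: ensemble_XC_def cq_state_def ensemble_state_def ensemble_weight_def)
  qed
  then show ?thesis
    by (simp add: diag_state_def) (simp add: ensemble_XC_def cq_state_def)
qed

lemma ensemble_weight_simps:
  assumes "c < d"
  shows "ensemble_weight d c = 1 / (2 * d)" "ensemble_weight d (d + c) = real (d - c) / (d * (real d + 1))"
  using assms by (auto simp: ensemble_weight_def)

lemma ensemble_weight_sum:
  assumes "0 < d"
  shows "(\<Sum>c<d. ensemble_weight d c) = 1 / 2" "(\<Sum>c<d. ensemble_weight d (d + c)) = 1 / 2"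
proof -
  show "(\<Sum>c<d. ensemble_weight d c) = 1 / 2"
    using assms by (simp add: ensemble_weight_simps)
  have "(\<Sum>c<m. real (m - c)) = m * (real m + 1) / 2" for m
    by (induction m) (simp_all add: sum_subtractf sum.distrib of_nat_diff Suc_diff_le field_simps)
  then show "(\<Sum>c<d. ensemble_weight d (d + c)) = 1 / 2"
    using assms by (simp add: ensemble_weight_simps flip: sum_divide_distrib)
qed

lemma rate_lower_bound:
  assumes d: "2 \<le> d" and ach: "achievable crit 2 d (ensemble_XC d) (ensemble_error d) R"
  shows "log 2 d - 7 \<le> R"
proof -
  let ?w = "ensemble_weight d"
  \<comment> \<open>No limit is taken: one protocol at one positive block length already forces the
    bound, and \<open>n\<close> cancels at the end.\<close>
  obtain n P where n: "0 < n" and P: "is_protocol 2 d (ensemble_XC d) n R P"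
    and crit: "meets_criterion crit 2 d (ensemble_XC d) n (ensemble_error d)
          (ptrace_mid (2 ^ n) (d ^ n) (d ^ n) (final_state 2 d (ensemble_XC d) n R P))"
    using eventually_happens[OF eventually_conj[OF ach[unfolded achievable_def] eventually_gt_at_top[of 0]]]
    by auto
  have d0: "0 < d" using d by simp
  have w1: "(\<Sum>x<2. \<Sum>c<d. ?w (x * d + c)) = 1"
    using ensemble_weight_sum[OF d0] by (simp add: sum_two)
  have w0: "0 \<le> ?w i" for i
    by (simp add: ensemble_weight_def)
  obtain W Q where ch: "iid_channel 2 d n (\<lambda>x c. ?w (x * d + c)) W"
    and Q: "\<And>c c'. c < d ^ n \<Longrightarrow> c' < d ^ n \<Longrightarrow> W c c' \<le> Q c'" "(\<Sum>c'<d ^ n. Q c') = real (message_size n R)"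
    and err: "\<And>l. l < n \<Longrightarrow> (\<Sum>x<2. \<Sum>a'<d. \<bar>(\<Sum>a<d. ?w (x * d + a) *
        iid_channel.letter_channel 2 d n (\<lambda>x c. ?w (x * d + c)) W l a a') - ?w (x * d + a')\<bar>) \<le> 2 * ensemble_error d"
    using protocol_letter_channel[OF P ensemble_XC_diag[OF d0] w1 w0 d0 crit] by blast
  interpret iid_channel 2 d n "\<lambda>x c. ?w (x * d + c)" W by (rule ch)
  have \<pi>_le: "\<pi> a \<le> 2 / d" if "a < d" for a
  proof -
    have "\<pi> a = 1 / (2 * d) + real (d - a) / (d * (real d + 1))"
      using that by (simp add: \<pi>_def sum_two ensemble_weight_simps)
    also have "real (d - a) / (d * (real d + 1)) \<le> 1 / d"
    proof -
      have "real (d - a) / (real d + 1) \<le> 1" by simp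
      from divide_right_mono[OF this, of "real d"] show ?thesis
        by (simp add: mult.commute)
    qed
    finally show ?thesis
      using d0 by (simp add: field_simps)
  qed
  \<comment> \<open>The loss computed below is (d + 1) / (3 d^3 log d), and 1/8 is the value of (d +
    1) / (3 d^3) at d = 2. In the exponent \<delta> then costs just 1/8 bit per letter.\<close>
  define \<delta> where "\<delta> = 1 / (8 * log 2 d)"
  have log1: "1 \<le> log 2 d"
    using d by simp
  have agree: "1 - \<delta> \<le> (\<Sum>a<d. \<pi> a * letter_channel l a a)" if l: "l < n" for l
  proof -
    let ?V = "letter_channel l"
    have V_sum: "(\<Sum>a'<d. ?V a a') = 1" if "a < d" for a
      using letter_channel_sum[OF l that] .
    have V_le: "?V a a \<le> 1" if "a < d" for a
      using member_le_sum[of a "{..<d}" "?V a"] that V_sum[OF that] by (simp add: letter_channel_nonneg)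
    have "(\<Sum>a'<d. \<bar>(\<Sum>a<d. 1 / (2 * d) * ?V a a') - 1 / (2 * d)\<bar>) +
      (\<Sum>a'<d. \<bar>(\<Sum>a<d. real (d - a) / (d * (real d + 1)) * ?V a a') - real (d - a') / (d * (real d + 1))\<bar>)
      \<le> 2 * ensemble_error d"
      using err[OF l] by (simp add: sum_two ensemble_weight_simps cong: sum.cong_simp)
    then have stay: "(\<Sum>a<d. 1 - ?V a a) \<le> 2 * real d ^ 2 * (real d + 1) * (2 * ensemble_error d)"
      using V_sum d0 by (intro linear_law_rigidity) (auto simp: letter_channel_nonneg)
    have "(\<Sum>a<d. \<pi> a * (1 - ?V a a)) \<le> (\<Sum>a<d. 2 / d * (1 - ?V a a))"
      using \<pi>_le V_le by (intro sum_mono mult_right_mono) auto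
    also have "\<dots> = 2 / d * (\<Sum>a<d. 1 - ?V a a)"
      by (simp only: sum_distrib_left)
    also have "\<dots> \<le> 2 / d * (2 * real d ^ 2 * (real d + 1) * (2 * ensemble_error d))"
      by (intro mult_left_mono stay) simp
    also have "\<dots> = (real d + 1) / (3 * real d ^ 3 * log 2 d)"
      using d0 log1 by (simp add: ensemble_error_def divide_simps) (simp add: algebra_simps eval_nat_numeral)
    also have "\<dots> \<le> \<delta>"
    proof -
      have "8 * (real d + 1) \<le> 3 * real d ^ 3"
      proof -
        have "4 * real d \<le> real d ^ 3"
          using mult_right_mono[OF mult_mono[of 2 "real d" 2 "real d"], of "real d"] d
          by (simp add: power3_eq_cube)
        then have "3 * (4 * real d) \<le> 3 * real d ^ 3" by simp
        moreover have "8 * (real d + 1) \<le> 3 * (4 * real d)" using d by simp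
        ultimately show ?thesis by (rule order.trans[rotated])
      qed
      then have "(real d + 1) / (3 * real d ^ 3) \<le> 1 / 8"
        using d0 by (simp add: divide_le_eq)
      then have "(real d + 1) / (3 * real d ^ 3) / log 2 d \<le> 1 / 8 / log 2 d"
        using log1 by (intro divide_right_mono) auto
      then show ?thesis by (simp add: \<delta>_def)
    qed
    finally have "(\<Sum>a<d. \<pi> a * (1 - ?V a a)) \<le> \<delta>" .
    moreover have "(\<Sum>a<d. \<pi> a * (1 - ?V a a)) = 1 - (\<Sum>a<d. \<pi> a * ?V a a)"
      by (simp add: right_diff_distrib sum_subtractf \<pi>_sum)
    ultimately show ?thesis by simp
  qed
  have "real (message_size n R) \<le> 2 powr (real n * R)"
    by (simp add: message_size_def)
  also have "\<dots> = exp (real n * R * ln 2)"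
    by (simp add: powr_def)
  finally have T: "real (message_size n R) * 3 ^ n \<le> exp (real n * R * ln 2) * 3 ^ n"
    by (intro mult_right_mono) auto
  have "exp (real n * (1 - \<delta>) * ln d) \<le> real (message_size n R) * 3 ^ n"
    by (rule agreements_bound[OF d \<pi>_le agree Q])
  also have "\<dots> \<le> exp (real n * R * ln 2) * 3 ^ n"
    by (rule T)
  also have "(3 :: real) ^ n = exp (real n * ln 3)"
    by (simp add: exp_of_nat_mult)
  also have "exp (real n * R * ln 2) * exp (real n * ln 3) = exp (real n * (R * ln 2 + ln 3))"
    by (simp add: exp_add ring_distribs mult.assoc)
  finally have "real n * ((1 - \<delta>) * ln d) \<le> real n * (R * ln 2 + ln 3)"
    by (simp add: mult.assoc)
  then have "(1 - \<delta>) * ln d \<le> R * ln 2 + ln 3"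
    using n by simp
  moreover have "ln 3 \<le> 2 * ln (2 :: real)"
  proof -
    have "ln 3 \<le> ln (4 :: real)" by simp
    also have "ln (4 :: real) = 2 * ln 2" using ln_realpow[of "2 :: real" 2] by simp
    finally show ?thesis .
  qed
  moreover have "ln d = log 2 d * ln 2"
    by (simp add: log_def)
  ultimately have "(1 - \<delta>) * log 2 d * ln 2 \<le> (R + 2) * ln 2"
    by (simp add: ring_distribs mult.assoc)
  then have "(1 - \<delta>) * log 2 d \<le> R + 2"
    by simp
  moreover have "(1 - \<delta>) * log 2 d = log 2 d - 1 / 8"
    using log1 by (simp add: \<delta>_def left_diff_distrib)
  \<comment> \<open>The total loss is 2 bits for log 3 and 1/8 bit for \<delta>, well within the
    allowance of 7.\<close>
  ultimately show ?thesis by simp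
qed

section \<open>The information defect of the ensemble\<close>

lemma ensemble_mutual_information:
  assumes d: "0 < d"
  shows "0 \<le> mutual_information 2 d (ensemble_XC d)" "mutual_information 2 d (ensemble_XC d) \<le> 1"
proof -
  have pos: "0 < ensemble_weight d (x * d + c)" if "x < 2" "c < d" for x c
    using that d by (auto simp: ensemble_weight_def)
  show "0 \<le> mutual_information 2 d (ensemble_XC d)"
    by (rule mutual_information_nonneg[OF ensemble_XC_diag[OF d] pos])
       (simp_all add: sum_two ensemble_weight_sum[OF d])
  show "mutual_information 2 d (ensemble_XC d) \<le> 1"
    using mutual_information_le_entropy[OF ensemble_XC_diag[OF d] pos]
    by (simp add: sum_two ensemble_weight_sum[OF d] log_divide)
qed

lemma information_defect_bounds:
  assumes d: "2 \<le> d"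
  shows "ereal (log 2 (real d) - 8) \<le> information_defect crit 2 d (ensemble_XC d) (ensemble_error d)"
    and "information_defect crit 2 d (ensemble_XC d) (ensemble_error d) \<le> ereal (log 2 (real d))"
proof -
  have d0: "0 < d" using d by simp
  let ?S = "{R. achievable crit 2 d (ensemble_XC d) (ensemble_error d) R}"
  let ?I = "mutual_information 2 d (ensemble_XC d)"
  have lower: "ereal (log 2 (real d) - 7) \<le> (INF R \<in> ?S. ereal R)"
    using rate_lower_bound[OF d] by (intro INF_greatest) simp
  have "ereal (log 2 (real d) - 8) \<le> ereal (log 2 (real d) - 7) - ereal ?I"
    using ensemble_mutual_information(2)[OF d0] by simp
  also have "\<dots> \<le> (INF R \<in> ?S. ereal R) - ereal ?I"
    by (intro ereal_minus_mono lower) simp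
  finally show "ereal (log 2 (real d) - 8) \<le> information_defect crit 2 d (ensemble_XC d) (ensemble_error d)"
    by (simp add: information_defect_def)
  have "0 \<le> ensemble_error d"
    using d by (simp add: ensemble_error_def)
  then have "log 2 (real d) \<in> ?S"
    using achievable_log_dim[OF d0 ensemble_XC_diag[OF d0]] by (simp add: sum_two ensemble_weight_sum[OF d0])
  then have "(INF R \<in> ?S. ereal R) \<le> ereal (log 2 (real d))"
    by (rule INF_lower)
  then have "(INF R \<in> ?S. ereal R) - ereal ?I \<le> ereal (log 2 (real d)) - ereal ?I"
    by (intro ereal_minus_mono) auto
  also have "\<dots> \<le> ereal (log 2 (real d))"
    using ensemble_mutual_information(1)[OF d0] by simp
  finally show "information_defect crit 2 d (ensemble_XC d) (ensemble_error d) \<le> ereal (log 2 (real d))"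
    by (simp add: information_defect_def)
qed

lemma information_defect_unbounded:
  "\<exists>d::nat. d \<ge> 2 \<and> (\<forall>crit. information_defect crit 2 d (ensemble_XC d) (ensemble_error d) \<ge> ereal K)"
proof -
  \<comment> \<open>With \<open>d = 2 ^ m\<close> the lower bound on the defect is
    \<open>m - 8\<close>; positivity of \<open>m\<close> ensures \<open>2 \<le> d\<close>.\<close>
  define m where "m = nat \<lceil>\<bar>K\<bar>\<rceil> + 8"
  have m: "K \<le> real m - 8" "0 < m"
    by (auto simp: m_def) linarith
  have "2 ^ 1 \<le> (2 :: nat) ^ m"
    using m(2) by (intro power_increasing) auto
  then have d: "2 \<le> (2 :: nat) ^ m" by simp
  have "log 2 (real (2 ^ m)) = m"
    by (simp add: log_nat_power)
  then have "ereal K \<le> information_defect crit 2 (2 ^ m) (ensemble_XC (2 ^ m)) (ensemble_error (2 ^ m))" for crit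
    using information_defect_bounds(1)[OF d, of crit] m(1) by (metis ereal_less_eq(3) order.trans)
  then show ?thesis
    using d by blast
qed

text \<open>The asymptotic form of near-maximality: the defect lies between log d - 8 and log d, so
  its leading term is log d.\<close>

lemma information_defect_ratio:
  "((\<lambda>d::nat. information_defect crit 2 d (ensemble_XC d) (ensemble_error d) / ereal (log 2 (real d)))
     \<longlongrightarrow> 1) sequentially"
proof -
  have "((\<lambda>d::nat. (log 2 (real d) - 8) / log 2 (real d)) \<longlongrightarrow> 1) sequentially"
    by real_asymp
  then have lower: "((\<lambda>d::nat. ereal ((log 2 (real d) - 8) / log 2 (real d))) \<longlongrightarrow> 1) sequentially"
    by (simp add: one_ereal_def)
  show ?thesis
  proof (rule tendsto_sandwich[OF _ _ lower tendsto_const])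
    show "\<forall>\<^sub>F d in sequentially. ereal ((log 2 (real d) - 8) / log 2 (real d)) \<le>
        information_defect crit 2 d (ensemble_XC d) (ensemble_error d) / ereal (log 2 (real d))"
      using eventually_ge_at_top[of 2]
    proof eventually_elim
      case (elim d)
      then have "0 < log 2 (real d)" by simp
      then show ?case
        using ereal_divide_right_mono[OF information_defect_bounds(1)[OF elim, of crit], of "ereal (log 2 (real d))"]
        by simp
    qed
    show "\<forall>\<^sub>F d in sequentially.
        information_defect crit 2 d (ensemble_XC d) (ensemble_error d) / ereal (log 2 (real d)) \<le> 1"
      using eventually_ge_at_top[of 2]
    proof eventually_elim
      case (elim d)
      then have "0 < log 2 (real d)" by simp
      then show ?case
        using ereal_divide_right_mono[OF information_defect_bounds(2)[OF elim, of crit], of "ereal (log 2 (real d))"]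
        by (simp add: one_ereal_def)
    qed
  qed
qed

theorem theorem1:
  shows "(\<forall>d::nat. d \<ge> 2 \<longrightarrow>
            mutual_information 2 d (ensemble_XC d) \<le> 1 \<and>
            (\<forall>crit.
               (\<forall>R::real. achievable crit 2 d (ensemble_XC d) (ensemble_error d) R \<longrightarrow>
                  R \<ge> log 2 (real d) - 7) \<and>
               information_defect crit 2 d (ensemble_XC d) (ensemble_error d)
                 \<ge> ereal (log 2 (real d) - 8) \<and>
               information_defect crit 2 d (ensemble_XC d) (ensemble_error d)
                 \<le> ereal (log 2 (real d))))
         \<and> (\<forall>K::real. \<exists>d::nat. d \<ge> 2 \<and>
              (\<forall>crit. information_defect crit 2 d (ensemble_XC d) (ensemble_error d) \<ge> ereal K))
         \<and> (\<forall>crit. ((\<lambda>d::nat. information_defect crit 2 d (ensemble_XC d) (ensemble_error d)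
                        / ereal (log 2 (real d))) \<longlongrightarrow> 1) sequentially)"
  using ensemble_mutual_information(2) rate_lower_bound information_defect_bounds
    information_defect_unbounded information_defect_ratio
  by simp

end
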